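(* Let $k$ be a field, let $V$ be an arbitrary $k$-vector space, and let $\varphi, \phi \in \operatorname{End}_k(V)$ be two finite potent endomorphisms of $V$, with AST-decompositions $V = U_\varphi \oplus W_\varphi$ and $V = U_\phi \oplus W_\phi$. Let $n$ be the order of nilpotency of $\varphi|_{U_\varphi}$, and let $p_1(x)^{n_1} \cdots p_r(x)^{n_r}$ be the annihilator polynomial of $\varphi|_{W_\varphi}$, with $p_1, \dots, p_r$ distinct irreducible polynomials in $k[x]$. Then there exists $\tau \in \operatorname{Aut}_k(V)$ with $\phi = \tau \varphi \tau^{-1}$ if and only if (i) $\mu_i(U_\varphi, \varphi|_{U_\varphi}) = \mu_i(U_\phi, \phi|_{U_\phi})$ for all $1 \leq i \leq n$; and (ii) $\nu_s(W_\varphi, p_j(\varphi|_{W_\varphi})) = \nu_s(W_\phi, p_j(\phi|_{W_\phi}))$ for all $1 \leq j \leq r$ and $1 \leq s \leq n_j$.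
   Context: An endomorphism $\varphi$ of a $k$-vector space $V$ is finite potent if $\varphi^m(V)$ is finite-dimensional for some $m$. In that case $V$ has a unique $\varphi$-invariant decomposition $V = U_\varphi \oplus W_\varphi$ (the AST-decomposition) such that $\varphi|_{U_\varphi}$ is nilpotent, $W_\varphi$ is finite-dimensional and $\varphi|_{W_\varphi} : W_\varphi \to W_\varphi$ is an isomorphism. Explicitly, $U_\varphi = \{v \in V : \varphi^m(v) = 0 \text{ for some } m\}$ and $W_\varphi = \{v \in V : p(\varphi)(v) = 0 \text{ for some } p(x) \in k[x] \text{ relatively prime to } x\}$. A nilpotent endomorphism $f$ has order $n$ if $f^n = 0$ and $f^{n-1} \neq 0$. For a nilpotent endomorphism $f$ of a $k$-vector space $U$ and $i \ge 1$, $$\mu_i(U,f) = \dim_k\big( \operatorname{Ker} f^i / [\operatorname{Ker} f^{i-1} + f(\operatorname{Ker} f^{i+1})]\big),$$ a (possibly infinite) cardinal. The annihilator polynomial of an endomorphism $T$ of a finite-dimensional space $W$ is its minimal polynomial. For an irreducible polynomial $p(x) \in k[x]$ and $s \ge 1$, $$\nu_s(W,p(T)) = \dim_K\big( \operatorname{Ker} p(T)^s / [\operatorname{Ker} p(T)^{s-1} + p(T)(\operatorname{Ker} p(T)^{s+1})]\big),\quad K = k[x]/(p(x)),$$ where $x$ acts as $T$.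
   Formalization: For infinite-dimensional V the claim fails as printed (zero map versus a rank-one projection); there the equivalence is proved with (i) required for all i ≥ 1 and (ii) for all irreducible polynomials and all s ≥ 1. For finite-dimensional V it is as printed. *)

theory Defs
  imports "Jordan_Normal_Form.VS_Connect" "HOL-Algebra.QuotRing"
begin

unbundle cardinal_syntax

text \<open>
  A vector space \<open>V\<close> over a field \<open>'k\<close> is the whole type \<open>'v\<close> with a scalar multiplication
  \<open>scale\<close> satisfying \<open>vector_space scale\<close>. The restriction of an endomorphism to an invariant
  subspace \<open>U\<close> is represented by the pair of \<open>U\<close> and the endomorphism of \<open>V\<close>.
\<close>

definition finite_dim :: "('k::field \<Rightarrow> 'v::ab_group_add \<Rightarrow> 'v) \<Rightarrow> 'v set \<Rightarrow> bool" where
  "finite_dim scale S \<longleftrightarrow> (\<exists>B. finite B \<and> Modules.module.span scale B = S)"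

definition finite_potent :: "('k::field \<Rightarrow> 'v::ab_group_add \<Rightarrow> 'v) \<Rightarrow> ('v \<Rightarrow> 'v) \<Rightarrow> bool" where
  "finite_potent scale f \<longleftrightarrow>
     Vector_Spaces.linear scale scale f \<and> (\<exists>m. finite_dim scale (range (f ^^ m)))"

definition AST_decomposition ::
  "('k::field \<Rightarrow> 'v::ab_group_add \<Rightarrow> 'v) \<Rightarrow> ('v \<Rightarrow> 'v) \<Rightarrow> 'v set \<Rightarrow> 'v set \<Rightarrow> bool" where
  "AST_decomposition scale f U W \<longleftrightarrow>
     Modules.module.subspace scale U \<and> Modules.module.subspace scale W \<and>
     U \<inter> W = {0} \<and> {u + w | u w. u \<in> U \<and> w \<in> W} = UNIV \<and>
     f ` U \<subseteq> U \<and> f ` W \<subseteq> W \<and>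
     (\<exists>m. \<forall>u\<in>U. (f ^^ m) u = 0) \<and>
     finite_dim scale W \<and> bij_betw f W W"

text \<open>The zero space has \<open>f ^^ 0 = id = 0\<close>, so there the order of nilpotency is \<open>0\<close>.\<close>

definition nilpotency_order :: "'v::zero set \<Rightarrow> ('v \<Rightarrow> 'v) \<Rightarrow> nat \<Rightarrow> bool" where
  "nilpotency_order U f n \<longleftrightarrow>
     (\<forall>u\<in>U. (f ^^ n) u = 0) \<and> (n \<noteq> 0 \<longrightarrow> (\<exists>u\<in>U. (f ^^ (n - 1)) u \<noteq> 0))"

definition poly_endo ::
  "('k::field \<Rightarrow> 'v::ab_group_add \<Rightarrow> 'v) \<Rightarrow> 'k poly \<Rightarrow> ('v \<Rightarrow> 'v) \<Rightarrow> 'v \<Rightarrow> 'v" where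
  "poly_endo scale q T v = (\<Sum>i\<le>degree q. scale (coeff q i) ((T ^^ i) v))"

definition annihilator_polynomial ::
  "('k::field \<Rightarrow> 'v::ab_group_add \<Rightarrow> 'v) \<Rightarrow> 'v set \<Rightarrow> ('v \<Rightarrow> 'v) \<Rightarrow> 'k poly \<Rightarrow> bool" where
  "annihilator_polynomial scale W T m \<longleftrightarrow>
     lead_coeff m = 1 \<and> (\<forall>q. (\<forall>w\<in>W. poly_endo scale q T w = 0) \<longleftrightarrow> m dvd q)"

text \<open>
  For a ring \<open>R\<close> acting through \<open>act\<close> on a group \<open>A\<close> and an invariant subgroup \<open>B\<close>, the
  \<open>R\<close>-module \<open>A / B\<close> of cosets. The ring multiplication fields of the record type play no role
  in a module.
\<close>

definition quotient_module ::
  "('r \<Rightarrow> 'v::ab_group_add \<Rightarrow> 'v) \<Rightarrow> 'v set \<Rightarrow> 'v set \<Rightarrow> ('r, 'v set) module" where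
  "quotient_module act A B =
     \<lparr>carrier = (\<lambda>a. {a + b | b. b \<in> B}) ` A,
      mult = undefined, one = undefined,
      zero = B, add = (\<lambda>X Y. {x + y | x y. x \<in> X \<and> y \<in> Y}),
      smult = (\<lambda>r X. {act r x + b | x b. x \<in> X \<and> b \<in> B})\<rparr>"

text \<open>The field \<open>K = k[x] / (p)\<close>; its elements are cosets, that is, sets of polynomials.\<close>

definition residue_field :: "'k::field poly \<Rightarrow> 'k poly set ring" where
  "residue_field p = class_ring Quot (PIdl\<^bsub>class_ring\<^esub> p)"

text \<open>
  A \<open>k[x]\<close>-module annihilated by \<open>p\<close>, regarded as a \<open>K\<close>-vector space: a coset acts as any of its
  representatives, and these all give the same result, so the union is that result.
\<close>

definition residue_space ::
  "('k::field poly, 'v set) module \<Rightarrow> ('k poly set, 'v set) module" where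
  "residue_space M =
     \<lparr>carrier = carrier M, mult = mult M, one = one M, zero = zero M, add = add M,
      smult = (\<lambda>C X. \<Union>q\<in>C. q \<odot>\<^bsub>M\<^esub> X)\<rparr>"

text \<open>
  The dimension as a possibly infinite cardinal, represented by the cardinal order of a basis;
  equality of dimensions is \<open>=o\<close>.
\<close>

definition dimension :: "('a, 'r) ring_scheme \<Rightarrow> ('a, 'b, 'm) module_scheme \<Rightarrow> 'b rel" where
  "dimension K M = |SOME X. vectorspace.basis K M X|"

definition ker_pow :: "'v::zero set \<Rightarrow> ('v \<Rightarrow> 'v) \<Rightarrow> nat \<Rightarrow> 'v set" where
  "ker_pow U f i = {u \<in> U. (f ^^ i) u = 0}"

definition ker_sum :: "'v::ab_group_add set \<Rightarrow> ('v \<Rightarrow> 'v) \<Rightarrow> nat \<Rightarrow> 'v set" where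
  "ker_sum U f i =
     {a + b | a b. a \<in> ker_pow U f (i - 1) \<and> b \<in> f ` ker_pow U f (i + 1)}"

definition mu ::
  "('k::field \<Rightarrow> 'v::ab_group_add \<Rightarrow> 'v) \<Rightarrow> 'v set \<Rightarrow> ('v \<Rightarrow> 'v) \<Rightarrow> nat \<Rightarrow> 'v set rel" where
  "mu scale U f i =
     dimension (class_ring :: 'k ring)
       (quotient_module scale (ker_pow U f i) (ker_sum U f i))"

definition nu ::
  "('k::field \<Rightarrow> 'v::ab_group_add \<Rightarrow> 'v) \<Rightarrow> 'v set \<Rightarrow> 'k poly \<Rightarrow> ('v \<Rightarrow> 'v) \<Rightarrow> nat \<Rightarrow> 'v set rel" where
  "nu scale W p T s =
     dimension (residue_field p)
       (residue_space
         (quotient_module (\<lambda>q. poly_endo scale q T)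
           (ker_pow W (poly_endo scale p T) s) (ker_sum W (poly_endo scale p T) s)))"

end

theory Submission
  imports Defs "HOL-Library.Product_Plus"
begin

text \<open>
  The finite potent endomorphism makes \<open>V\<close> a module over \<open>k[x]\<close> that is annihilated by a nonzero
  polynomial, and \<open>\<mu>\<close> and \<open>\<nu>\<close> are the dimensions over \<open>k[x] / (q)\<close> of
  \<open>Ker q ^ s / (Ker q ^ (s - 1) + q Ker q ^ (s + 1))\<close> for \<open>q = x\<close> and for the monic irreducible
  \<open>q \<noteq> x\<close>, with all kernels taken in \<open>V\<close>. Lifts to \<open>V\<close> of bases of these quotients generate
  cyclic submodules \<open>k[x] / (q ^ s)\<close> of which \<open>V\<close> is the direct sum. A matching of the lifted
  bases for two endomorphisms therefore extends to an injective homomorphism of \<open>k[x]\<close>-modules,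
  which is bijective if the matching is. If \<open>V\<close> has finite dimension, an injective matching suffices,
  so the invariants that are nonzero for the first endomorphism are enough.
\<close>

subsection \<open>Comaximal and irreducible polynomials\<close>

text \<open>Conditions (i) and (ii) only see the orders and primes that occur for \<phi>, and in
  infinite dimension this is too little. For \<phi> = 0 on an infinite-dimensional V they reduce to
  the equality of \<open>mu\<close> at order 1, which also holds if \<psi> has rank one and is
  idempotent or of square zero; yet such a \<psi> is not similar to 0. This is why the statement
  compares all invariants when V has infinite dimension.

  In finite dimension the invariants of \<psi> that (i) and (ii) do not see are controlled by a
  count: the matching embeds V, generated by the summands of \<phi>, into V itself, and an injective
  linear map of V into itself leaves no room for further summands of \<psi>.\<close>

definition comaximal :: "'r::comm_ring_1 \<Rightarrow> 'r \<Rightarrow> bool" where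
  "comaximal a b \<longleftrightarrow> (\<exists>x y. x * a + y * b = 1)"

lemma comaximal_commute: "comaximal a b \<Longrightarrow> comaximal b a"
  unfolding comaximal_def by (metis add.commute)

lemma comaximal_one_right [simp]: "comaximal a 1"
  unfolding comaximal_def by (rule exI[of _ 0], rule exI[of _ 1]) simp

lemma comaximal_mult_right:
  assumes "comaximal a b" "comaximal a c"
  shows "comaximal a (b * c)"
proof -
  obtain x y z w where "x * a + y * b = 1" "z * a + w * c = 1"
    using assms by (auto simp: comaximal_def)
  then have "(x * a + y * b) * (z * a + w * c) = 1" by simp
  then have "(x * z * a + x * w * c + y * z * b) * a + (y * w) * (b * c) = 1"
    by (simp add: algebra_simps)
  then show ?thesis unfolding comaximal_def by blast
qed

lemma comaximal_power_right: "comaximal a b \<Longrightarrow> comaximal a (b ^ n)"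
  by (induction n) (auto intro: comaximal_mult_right)

lemma comaximal_power_left: "comaximal a b \<Longrightarrow> comaximal (a ^ n) b"
  by (meson comaximal_commute comaximal_power_right)

lemma comaximal_prod_right:
  "(\<And>i. i \<in> A \<Longrightarrow> comaximal a (f i)) \<Longrightarrow> comaximal a (prod f A)"
  by (induction A rule: infinite_finite_induct) (auto intro: comaximal_mult_right)

lemma comaximal_dvd_mult:
  assumes "comaximal a b" "a dvd b * c"
  shows "a dvd c"
proof -
  obtain x y where "x * a + y * b = 1"
    using assms by (auto simp: comaximal_def)
  then have "(x * a + y * b) * c = c" by simp
  then have eq: "x * c * a + y * (b * c) = c" by (simp add: algebra_simps)
  have "a dvd x * c * a + y * (b * c)"
    using assms(2) by (meson dvd_add dvd_mult dvd_refl)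
  then show ?thesis unfolding eq .
qed

text \<open>A nonzero element \<open>d\<close> of least degree in the ideal (p, q) divides all of
  it, since a nonzero remainder would have smaller degree. If \<open>d\<close> were not a unit, it
  would be an associate of \<open>p\<close>, and \<open>p\<close> would divide
  \<open>q\<close>.\<close>

lemma irreducible_comaximal:
  fixes p :: "'k::field poly"
  assumes p: "irreducible p" and q: "\<not> p dvd q"
  shows "comaximal p q"
proof -
  define S where "S = {d. d \<noteq> 0 \<and> (\<exists>x y. d = x * p + y * q)}"
  have "p \<in> S"
  proof -
    have "p = 1 * p + 0 * q" by simp
    then show ?thesis using p unfolding S_def irreducible_def by blast
  qed
  then obtain d where d: "d \<in> S" and min: "\<And>e. e \<in> S \<Longrightarrow> degree d \<le> degree e"
    using ex_has_least_nat[of "\<lambda>d. d \<in> S" _ degree] by blast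
  obtain x y where xy: "d = x * p + y * q" and "d \<noteq> 0"
    using d by (auto simp: S_def)
  have dvd: "d dvd u * p + v * q" for u v
  proof (rule ccontr)
    assume "\<not> d dvd u * p + v * q"
    then have nz: "(u * p + v * q) mod d \<noteq> 0" by (simp add: dvd_eq_mod_eq_0)
    define t where "t = (u * p + v * q) div d"
    have "(u * p + v * q) mod d = (u * p + v * q) - t * d"
      by (simp add: t_def minus_div_mult_eq_mod)
    also have "\<dots> = (u - t * x) * p + (v - t * y) * q"
      by (simp add: xy algebra_simps)
    finally have "(u * p + v * q) mod d = (u - t * x) * p + (v - t * y) * q" .
    with nz have "(u * p + v * q) mod d \<in> S" by (auto simp: S_def)
    from min[OF this] show False
      using degree_mod_less'[OF \<open>d \<noteq> 0\<close> nz] by simp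
  qed
  have "d dvd p" "d dvd q" using dvd[of 1 0] dvd[of 0 1] by simp_all
  have "d dvd 1"
  proof (rule ccontr)
    assume "\<not> d dvd 1"
    obtain e where e: "p = d * e" using \<open>d dvd p\<close> by (auto simp: dvd_def)
    with p \<open>\<not> d dvd 1\<close> have "e dvd 1" by (auto simp: irreducible_def)
    then have "p dvd d" by (simp add: e mult_unit_dvd_iff)
    with \<open>d dvd q\<close> q show False using dvd_trans by blast
  qed
  then obtain e where "1 = d * e" by (auto simp: dvd_def)
  then have "(e * x) * p + (e * y) * q = 1" by (simp add: xy algebra_simps)
  then show ?thesis unfolding comaximal_def by blast
qed

text \<open>A nonunit divisor of least degree is irreducible. Division by its leading coefficient
  makes it monic, so that later each prime is represented exactly once.\<close>

lemma irreducible_factor_exists: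
  fixes m :: "'k::field poly"
  assumes "m \<noteq> 0" "\<not> m dvd 1"
  shows "\<exists>p. irreducible p \<and> lead_coeff p = 1 \<and> p dvd m"
proof -
  define S where "S = {d. d dvd m \<and> \<not> d dvd 1}"
  have "m \<in> S" using assms by (auto simp: S_def)
  then obtain d where d: "d \<in> S" and min: "\<And>e. e \<in> S \<Longrightarrow> degree d \<le> degree e"
    using ex_has_least_nat[of "\<lambda>d. d \<in> S" _ degree] by blast
  have dm: "d dvd m" and nu: "\<not> d dvd 1" and "d \<noteq> 0" using d assms by (auto simp: S_def)
  have "irreducible d"
  proof (rule irreducibleI)
    fix a b assume ab: "d = a * b"
    show "a dvd 1 \<or> b dvd 1"
    proof (rule ccontr)
      assume H: "\<not> (a dvd 1 \<or> b dvd 1)"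
      then have "a \<in> S" using dm ab by (auto simp: S_def intro: dvd_mult_left)
      then have "degree d \<le> degree a" by (rule min)
      moreover have "degree d = degree a + degree b" "a \<noteq> 0" "b \<noteq> 0"
        using ab \<open>d \<noteq> 0\<close> by (auto simp: degree_mult_eq)
      ultimately have "degree b = 0" by simp
      then show False using H \<open>b \<noteq> 0\<close> is_unit_iff_degree by blast
    qed
  qed (use nu \<open>d \<noteq> 0\<close> in auto)
  define c where "c = inverse (lead_coeff d)"
  have "c \<noteq> 0" using \<open>d \<noteq> 0\<close> by (simp add: c_def)
  have un: "[:c:] dvd 1" using \<open>c \<noteq> 0\<close> by (simp add: is_unit_iff_degree)
  have eq: "Polynomial.smult c d = [:c:] * d" by simp
  have "irreducible (Polynomial.smult c d)"
    unfolding eq using irreducible_mult_unit_left[OF un] \<open>irreducible d\<close> by blast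
  moreover have "lead_coeff (Polynomial.smult c d) = 1"
    using \<open>d \<noteq> 0\<close> by (simp add: c_def)
  moreover have "Polynomial.smult c d dvd m"
    using dm \<open>c \<noteq> 0\<close> by (simp add: smult_dvd_iff)
  ultimately show ?thesis by blast
qed

lemma monic_irreducible_dvd_eq:
  fixes p q :: "'k::field poly"
  assumes "irreducible p" "irreducible q" "lead_coeff p = 1" "lead_coeff q = 1" "p dvd q"
  shows "p = q"
proof -
  obtain c where c: "q = p * c" using assms(5) by (auto simp: dvd_def)
  then have "c dvd 1" using assms(1,2) unfolding irreducible_def by blast
  then have "degree c = 0"
    by (metis is_unit_iff_degree dvd_0_left_iff zero_neq_one)
  then obtain a where "c = [:a:]" by (meson degree_eq_zeroE)
  with c assms show ?thesis by (auto split: if_splits)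
qed

lemma irreducible_x: "irreducible [:0, 1 :: 'k::field:]"
  by (simp add: irreducible_linear_field_poly)

lemma poly_power_decomposition:
  fixes m q :: "'k::field poly"
  assumes "m \<noteq> 0" "0 < degree q"
  shows "\<exists>N c. m = q ^ N * c \<and> \<not> q dvd c"
  using assms(1)
proof (induction "degree m" arbitrary: m rule: less_induct)
  case less
  show ?case
  proof (cases "q dvd m")
    case False
    then show ?thesis by (intro exI[of _ 0] exI[of _ m]) simp
  next
    case True
    then obtain d where d: "m = q * d" by (auto simp: dvd_def)
    with less.prems have "q \<noteq> 0" "d \<noteq> 0" by auto
    then have "degree d < degree m" using assms(2) by (simp add: d degree_mult_eq)
    then obtain N c where "d = q ^ N * c" "\<not> q dvd c" using less.hyps \<open>d \<noteq> 0\<close> by blast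
    then show ?thesis using d by (intro exI[of _ "Suc N"] exI[of _ c]) (simp add: mult.assoc)
  qed
qed

lemma irreducible_degree_pos:
  fixes q :: "'k::field poly"
  shows "irreducible q \<Longrightarrow> 0 < degree q"
  unfolding irreducible_def by (metis is_unit_iff_degree gr0I)

lemma monic_irreducible_comaximal:
  fixes p q :: "'k::field poly"
  assumes "irreducible p" "irreducible q" "lead_coeff p = 1" "lead_coeff q = 1" "p \<noteq> q"
  shows "comaximal p q"
  using assms irreducible_comaximal monic_irreducible_dvd_eq by metis

subsection \<open>Bases of quotient spaces\<close>

context vectorspace
begin

lemma basis_exists: "\<exists>X. basis X"
proof -
  define S where "S = {X. X \<subseteq> carrier V \<and> lin_indpt X}"
  have "\<exists>X\<in>S. \<forall>Y\<in>S. X \<subseteq> Y \<longrightarrow> Y = X"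
  proof (rule subset_Zorn')
    fix C assume C: "subset.chain S C"
    then have sub: "C \<subseteq> S" by (simp add: subset.chain_def)
    have "lin_indpt (\<Union>C)"
    proof
      assume "lin_dep (\<Union>C)"
      then obtain F a v where F: "finite F" "F \<subseteq> \<Union>C" "a \<in> F \<rightarrow> carrier K"
          "lincomb a F = \<zero>\<^bsub>V\<^esub>" "v \<in> F" "a v \<noteq> \<zero>\<^bsub>K\<^esub>"
        unfolding lin_dep_def by blast
      then have "C \<noteq> {}" by auto
      then obtain B where "B \<in> C" "F \<subseteq> B"
        using finite_subset_Union_chain[OF F(1,2) _ C] by blast
      then have "lin_dep B" using F lin_dep_crit by metis
      then show False using \<open>B \<in> C\<close> sub by (auto simp: S_def)
    qed
    then show "\<Union>C \<in> S" using sub by (auto simp: S_def)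
  qed
  then obtain X where "X \<in> S" "\<And>Y. Y \<in> S \<Longrightarrow> X \<subseteq> Y \<Longrightarrow> Y = X" by blast
  then have "maximal X (\<lambda>S. S \<subseteq> carrier V \<and> lin_indpt S)"
    unfolding maximal_def S_def by auto
  then show ?thesis using max_li_is_basis by blast
qed

text \<open>In the infinite case each vector of \<open>X\<close> is a combination of a finite subset
  of \<open>Y\<close>, and these subsets cover \<open>Y\<close>: if all of them missed
  \<open>y\<close>, the span of \<open>Y - {y}\<close> would contain \<open>X\<close> and hence
  \<open>y\<close>. A union of \<open>|X|\<close> finite sets has at most \<open>|X|\<close>
  elements.\<close>

lemma basis_card_of_ordLeq:
  assumes X: "basis X" and Y: "basis Y"
  shows "|Y| \<le>o |X|"
proof (cases "finite X")
  case True
  then have "fin_dim" using X unfolding fin_dim_def basis_def by blast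
  then have "finite Y" "card Y \<le> card X"
    using li_le_dim[of Y] dim_basis[OF True X] Y unfolding basis_def by auto
  then show ?thesis
    using True inj_on_iff_card_le[of Y X] card_of_ordLeq by blast
next
  case False
  have Xc: "X \<subseteq> carrier V" and Xs: "span X = carrier V"
    and Yc: "Y \<subseteq> carrier V" and Ys: "span Y = carrier V" and Yi: "lin_indpt Y"
    using X Y unfolding basis_def by auto
  have "\<exists>F. finite F \<and> F \<subseteq> Y \<and> x \<in> span F" if "x \<in> X" for x
  proof -
    have "x \<in> span Y" using that Xc Ys by auto
    then obtain F a where F: "finite F" "F \<subseteq> Y" "a \<in> F \<rightarrow> carrier K" "x = lincomb a F"
      unfolding span_def by blast
    then have "x \<in> span F" unfolding span_def by blast
    with F show ?thesis by blast
  qed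
  then obtain s where s: "\<And>x. x \<in> X \<Longrightarrow> finite (s x) \<and> s x \<subseteq> Y \<and> x \<in> span (s x)"
    by metis
  have "Y \<subseteq> (\<Union>x\<in>X. s x)"
  proof (rule ccontr)
    assume "\<not> ?thesis"
    then obtain y where y: "y \<in> Y" "\<And>x. x \<in> X \<Longrightarrow> y \<notin> s x" by blast
    have S: "Y - {y} \<subseteq> carrier V" using Yc by auto
    have "x \<in> span (Y - {y})" if "x \<in> X" for x
      using s[OF that] y(2)[OF that] span_is_monotone[of "s x" "Y - {y}"] by blast
    then have "span X \<subseteq> span (Y - {y})"
      using span_is_subset[OF _ span_is_submodule[OF S]] by blast
    then have "y \<in> span (Y - {y})" using Xs y Yc by auto
    moreover have "lin_indpt (Y - {y})" using subset_li_is_li[OF Yi] by blast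
    ultimately have "lin_dep (Y - {y} \<union> {y})"
      using lin_dep_iff_in_span[OF S] y Yc by blast
    then show False using Yi y by (simp add: insert_absorb)
  qed
  then have "|Y| \<le>o |\<Union>x\<in>X. s x|" by (rule card_of_mono1)
  also have "|\<Union>x\<in>X. s x| \<le>o |X|"
  proof (rule card_of_UNION_ordLeq_infinite[OF False ordLeq_reflexive[OF card_of_Well_order]], rule ballI)
    fix x assume "x \<in> X"
    then have "|s x| <o |X|"
      using s False by (intro finite_ordLess_infinite card_of_Well_order) (simp_all add: Field_card_of)
    then show "|s x| \<le>o |X|" by (rule ordLess_imp_ordLeq)
  qed
  finally show ?thesis .
qed

lemma basis_card_of_ordIso: "basis X \<Longrightarrow> basis Y \<Longrightarrow> |X| =o |Y|"
  by (simp add: basis_card_of_ordLeq ordIso_iff_ordLeq)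

end

text \<open>
  The family induces a basis of \<open>A / D\<close> over the residue ring modulo \<open>p\<close>; both the vectors and the
  scalars are given by representatives, so that no quotient occurs.
\<close>

definition quot_basis ::
  "('r::comm_ring_1 \<Rightarrow> 'v::ab_group_add \<Rightarrow> 'v) \<Rightarrow> 'r \<Rightarrow> 'v set \<Rightarrow> 'v set \<Rightarrow> 'i set \<Rightarrow> ('i \<Rightarrow> 'v) \<Rightarrow> bool"
  where
  "quot_basis act p A D I v \<longleftrightarrow>
     v ` I \<subseteq> A \<and>
     (\<forall>F r. finite F \<longrightarrow> F \<subseteq> I \<longrightarrow> (\<Sum>i\<in>F. act (r i) (v i)) \<in> D \<longrightarrow> (\<forall>i\<in>F. p dvd r i)) \<and>
     (\<forall>a\<in>A. \<exists>F r. finite F \<and> F \<subseteq> I \<and> a - (\<Sum>i\<in>F. act (r i) (v i)) \<in> D)"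

lemma quot_basis_mem: "quot_basis act p A D I v \<Longrightarrow> i \<in> I \<Longrightarrow> v i \<in> A"
  by (auto simp: quot_basis_def)

lemma quot_basis_dvd:
  "quot_basis act p A D I v \<Longrightarrow> finite F \<Longrightarrow> F \<subseteq> I \<Longrightarrow> (\<Sum>i\<in>F. act (r i) (v i)) \<in> D \<Longrightarrow>
    i \<in> F \<Longrightarrow> p dvd r i"
  by (simp add: quot_basis_def)

lemma quot_basis_spanE:
  assumes "quot_basis act p A D I v" "a \<in> A"
  obtains F r where "finite F" "F \<subseteq> I" "a - (\<Sum>i\<in>F. act (r i) (v i)) \<in> D"
proof -
  have "\<exists>F r. finite F \<and> F \<subseteq> I \<and> a - (\<Sum>i\<in>F. act (r i) (v i)) \<in> D"
    using assms by (simp add: quot_basis_def)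
  then show ?thesis using that by blast
qed

lemma quot_basis_not_mem:
  assumes "quot_basis act p A D I v" "i \<in> I" "\<not> p dvd 1" "Modules.module act"
  shows "v i \<in> A - D"
proof -
  interpret Modules.module act by fact
  have "v i \<notin> D"
    using quot_basis_dvd[OF assms(1), of "{i}" "\<lambda>_. 1" i] assms(2,3) by auto
  then show ?thesis using quot_basis_mem[OF assms(1,2)] by simp
qed

text \<open>
  The scalars are presented as the image of the acting ring under \<open>\<pi>\<close> with kernel \<open>(p)\<close>. For \<open>k[x]\<close>
  this covers \<open>k[x] / (q)\<close> and, through evaluation at \<open>0\<close> with \<open>p = x\<close>, the field \<open>k\<close> itself.
\<close>

locale coset_space = act: Modules.module act
  for act :: "'r::comm_ring_1 \<Rightarrow> 'v::ab_group_add \<Rightarrow> 'v" +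
  fixes p :: 'r and A D :: "'v set"
    and K :: "('c, 'm) ring_scheme" (structure) and \<pi> :: "'r \<Rightarrow> 'c"
    and M :: "('c, 'v set) module"
  assumes field_K: "field K"
    and \<pi>_surj: "range \<pi> = carrier K"
    and \<pi>_add: "\<pi> (a + b) = \<pi> a \<oplus> \<pi> b"
    and \<pi>_mult: "\<pi> (a * b) = \<pi> a \<otimes> \<pi> b"
    and \<pi>_one: "\<pi> 1 = \<one>"
    and \<pi>_eq_zero: "\<pi> a = \<zero> \<longleftrightarrow> p dvd a"
    and subspace_A: "act.subspace A" and subspace_D: "act.subspace D" and D_sub: "D \<subseteq> A"
    and carrier_M: "carrier M = (\<lambda>a. {a + b | b. b \<in> D}) ` A"
    and zero_M: "\<zero>\<^bsub>M\<^esub> = D"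
    and add_M: "X \<oplus>\<^bsub>M\<^esub> Y = {x + y | x y. x \<in> X \<and> y \<in> Y}"
    and smult_M: "w \<in> A \<Longrightarrow> \<pi> c \<odot>\<^bsub>M\<^esub> {w + b | b. b \<in> D} = {act c w + b | b. b \<in> D}"
begin

definition coset :: "'v \<Rightarrow> 'v set" where
  "coset a = {a + b | b. b \<in> D}"

lemma carrier_M': "carrier M = coset ` A"
  by (simp add: carrier_M coset_def)

lemma smult_coset: "w \<in> A \<Longrightarrow> \<pi> c \<odot>\<^bsub>M\<^esub> coset w = coset (act c w)"
  by (simp add: smult_M coset_def)

lemma mem_coset: "x \<in> coset a \<longleftrightarrow> x - a \<in> D"
proof
  assume "x - a \<in> D"
  then show "x \<in> coset a" unfolding coset_def by (intro CollectI exI[of _ "x - a"]) simp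
qed (auto simp: coset_def)

lemma coset_eq_iff: "coset a = coset b \<longleftrightarrow> a - b \<in> D"
proof
  assume "coset a = coset b"
  moreover have "a \<in> coset a" by (simp add: mem_coset act.subspace_0[OF subspace_D])
  ultimately show "a - b \<in> D" by (simp add: mem_coset)
next
  assume ab: "a - b \<in> D"
  have "x - a \<in> D \<longleftrightarrow> x - b \<in> D" for x
    using act.subspace_add[OF subspace_D, of "x - a" "a - b"]
      act.subspace_diff[OF subspace_D, of "x - b" "a - b"] ab by auto
  then show "coset a = coset b" by (auto simp: mem_coset)
qed

lemma coset_0: "coset 0 = D"
  by (auto simp: mem_coset)

lemma coset_eq_zero: "coset a = \<zero>\<^bsub>M\<^esub> \<longleftrightarrow> a \<in> D"
  using coset_eq_iff[of a 0] by (simp add: zero_M coset_0)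

lemma add_coset: "coset a \<oplus>\<^bsub>M\<^esub> coset b = coset (a + b)"
proof (intro equalityI subsetI)
  fix z assume "z \<in> coset a \<oplus>\<^bsub>M\<^esub> coset b"
  then obtain x y where "z = x + y" "x - a \<in> D" "y - b \<in> D" by (auto simp: add_M mem_coset)
  then show "z \<in> coset (a + b)"
    using act.subspace_add[OF subspace_D, of "x - a" "y - b"] by (simp add: mem_coset algebra_simps)
next
  fix z assume "z \<in> coset (a + b)"
  then have "z - b \<in> coset a" by (simp add: mem_coset algebra_simps)
  moreover have "b \<in> coset b" by (simp add: mem_coset act.subspace_0[OF subspace_D])
  ultimately show "z \<in> coset a \<oplus>\<^bsub>M\<^esub> coset b"
    unfolding add_M by (intro CollectI exI[of _ "z - b"] exI[of _ b]) simp
qed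

lemma coset_in_carrier: "a \<in> A \<Longrightarrow> coset a \<in> carrier M"
  by (simp add: carrier_M')

lemma carrierE:
  assumes "X \<in> carrier M"
  obtains a where "a \<in> A" "X = coset a"
  using assms by (auto simp: carrier_M')

lemma abelian_group_M: "abelian_group M"
proof (rule abelian_groupI)
  fix x assume "x \<in> carrier M"
  then obtain a where a: "a \<in> A" "x = coset a" by (rule carrierE)
  have "coset (- a) \<oplus>\<^bsub>M\<^esub> x = \<zero>\<^bsub>M\<^esub>" by (simp add: a add_coset coset_0 zero_M)
  then show "\<exists>y\<in>carrier M. y \<oplus>\<^bsub>M\<^esub> x = \<zero>\<^bsub>M\<^esub>"
    using a act.subspace_neg[OF subspace_A] coset_in_carrier by blast
next
  show "\<zero>\<^bsub>M\<^esub> \<in> carrier M"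
    using coset_in_carrier[OF act.subspace_0[OF subspace_A]] by (simp add: coset_0 zero_M)
  then show "\<zero>\<^bsub>M\<^esub> \<oplus>\<^bsub>M\<^esub> x = x" if "x \<in> carrier M" for x
    using that add_coset[of 0] by (elim carrierE) (simp add: zero_M coset_0)
qed (auto elim!: carrierE simp: add_coset algebra_simps
    intro!: coset_in_carrier act.subspace_add[OF subspace_A])

lemma \<pi>_in_carrier: "\<pi> r \<in> carrier K"
  using \<pi>_surj by blast

lemma \<pi>_E:
  assumes "c \<in> carrier K"
  obtains r where "c = \<pi> r"
  using assms \<pi>_surj by blast

lemma vectorspace_M: "vectorspace K M"
proof -
  interpret K: field K by (rule field_K)
  have "module K M"
  proof (rule moduleI)
    show "cring K" by (rule K.is_cring)
    show "abelian_group M" by (rule abelian_group_M)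
    show "\<one> \<odot>\<^bsub>M\<^esub> x = x" if "x \<in> carrier M" for x
      using that by (elim carrierE) (simp add: smult_coset flip: \<pi>_one)
  next
    fix a x assume "a \<in> carrier K" "x \<in> carrier M"
    then obtain r w where [simp]: "a = \<pi> r" "x = coset w" and w: "w \<in> A"
      by (elim carrierE \<pi>_E) simp
    show "a \<odot>\<^bsub>M\<^esub> x \<in> carrier M"
      using w by (simp add: smult_coset coset_in_carrier act.subspace_scale[OF subspace_A])
    fix y assume "y \<in> carrier M"
    then obtain z where [simp]: "y = coset z" and z: "z \<in> A" by (elim carrierE)
    show "a \<odot>\<^bsub>M\<^esub> (x \<oplus>\<^bsub>M\<^esub> y) = a \<odot>\<^bsub>M\<^esub> x \<oplus>\<^bsub>M\<^esub> a \<odot>\<^bsub>M\<^esub> y"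
      using w z act.subspace_add[OF subspace_A w z]
      by (simp add: smult_coset add_coset act.scale_right_distrib)
  next
    fix a b x assume "a \<in> carrier K" "b \<in> carrier K" "x \<in> carrier M"
    then obtain r s w where [simp]: "a = \<pi> r" "b = \<pi> s" "x = coset w" and w: "w \<in> A"
      by (elim carrierE \<pi>_E) simp
    show "(a \<oplus> b) \<odot>\<^bsub>M\<^esub> x = a \<odot>\<^bsub>M\<^esub> x \<oplus>\<^bsub>M\<^esub> b \<odot>\<^bsub>M\<^esub> x"
      using w by (simp add: smult_coset add_coset act.scale_left_distrib flip: \<pi>_add)
    show "(a \<otimes> b) \<odot>\<^bsub>M\<^esub> x = a \<odot>\<^bsub>M\<^esub> (b \<odot>\<^bsub>M\<^esub> x)"
      using w act.subspace_scale[OF subspace_A w]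
      by (simp add: smult_coset flip: \<pi>_mult)
  qed
  then show ?thesis by (intro vectorspace.intro field_K)
qed

sublocale vectorspace K M by (rule vectorspace_M)

lemma finsum_coset:
  assumes "finite F" "\<And>i. i \<in> F \<Longrightarrow> w i \<in> A"
  shows "(\<Oplus>\<^bsub>M\<^esub> i\<in>F. \<pi> (r i) \<odot>\<^bsub>M\<^esub> coset (w i)) = coset (\<Sum>i\<in>F. act (r i) (w i))"
  using assms
proof (induction F)
  case empty
  then show ?case by (simp add: coset_0 zero_M)
next
  case (insert x F)
  have "\<pi> (r i) \<odot>\<^bsub>M\<^esub> coset (w i) \<in> carrier M" if "i \<in> insert x F" for i
    using insert.prems[OF that]
    by (simp add: smult_coset coset_in_carrier act.subspace_scale[OF subspace_A])
  then have "(\<Oplus>\<^bsub>M\<^esub> i\<in>insert x F. \<pi> (r i) \<odot>\<^bsub>M\<^esub> coset (w i)) =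
      \<pi> (r x) \<odot>\<^bsub>M\<^esub> coset (w x) \<oplus>\<^bsub>M\<^esub> (\<Oplus>\<^bsub>M\<^esub> i\<in>F. \<pi> (r i) \<odot>\<^bsub>M\<^esub> coset (w i))"
    using insert.hyps by (intro M.finsum_insert) auto
  then show ?case using insert by (simp add: smult_coset add_coset)
qed

lemma lincomb_coset:
  assumes "finite F" "\<And>Y. Y \<in> F \<Longrightarrow> w Y \<in> A \<and> coset (w Y) = Y \<and> a Y = \<pi> (r Y)"
  shows "lincomb a F = coset (\<Sum>Y\<in>F. act (r Y) (w Y))"
proof -
  have "lincomb a F = (\<Oplus>\<^bsub>M\<^esub> Y\<in>F. \<pi> (r Y) \<odot>\<^bsub>M\<^esub> coset (w Y))"
    unfolding lincomb_def
    by (rule M.finsum_cong')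
      (use assms in \<open>auto simp: \<pi>_in_carrier intro!: smult_closed dest: coset_in_carrier\<close>)
  with finsum_coset[of F w r] assms show ?thesis by simp
qed

text \<open>The basis serves as its own index set, each coset being sent to a chosen representative.
  For the basis chosen by \<open>dimension\<close>, the cardinal of the index set is then equal to
  the dimension, not merely isomorphic to it.\<close>

lemma quot_basis_of_basis:
  assumes X: "basis X"
  shows "\<exists>w. quot_basis act p A D X w"
proof -
  have Xc: "X \<subseteq> carrier M" and Xs: "span X = carrier M" and Xi: "lin_indpt X"
    using X unfolding basis_def by auto
  have "\<forall>Y\<in>X. \<exists>a. a \<in> A \<and> coset a = Y" using Xc by (metis carrierE subsetD)
  then obtain w where w: "\<And>Y. Y \<in> X \<Longrightarrow> w Y \<in> A \<and> coset (w Y) = Y" by metis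
  have "\<forall>Y\<in>F. p dvd r Y"
    if F: "finite F" "F \<subseteq> X" "(\<Sum>Y\<in>F. act (r Y) (w Y)) \<in> D" for F r
  proof (rule ccontr)
    assume "\<not> ?thesis"
    then obtain Y where Y: "Y \<in> F" "\<pi> (r Y) \<noteq> \<zero>" by (auto simp: \<pi>_eq_zero)
    have "lincomb (\<lambda>Y. \<pi> (r Y)) F = coset (\<Sum>Y\<in>F. act (r Y) (w Y))"
      by (rule lincomb_coset) (use F w in auto)
    also have "\<dots> = \<zero>\<^bsub>M\<^esub>" using F by (simp add: coset_eq_zero)
    finally have "lin_dep X"
      using lin_dep_crit[of F X "\<lambda>Y. \<pi> (r Y)" Y] F Y \<pi>_in_carrier by auto
    then show False using Xi by blast
  qed
  moreover have "\<exists>F r. finite F \<and> F \<subseteq> X \<and> a - (\<Sum>Y\<in>F. act (r Y) (w Y)) \<in> D" if "a \<in> A" for a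
  proof -
    have "coset a \<in> span X" using Xs coset_in_carrier[OF that] by simp
    then obtain F c where F: "finite F" "F \<subseteq> X" "c \<in> F \<rightarrow> carrier K" "coset a = lincomb c F"
      unfolding span_def by blast
    have "\<forall>Y\<in>F. \<exists>r. c Y = \<pi> r" using F(3) \<pi>_surj by (auto simp: Pi_iff)
    then obtain r where r: "\<And>Y. Y \<in> F \<Longrightarrow> c Y = \<pi> (r Y)" by metis
    have "coset a = coset (\<Sum>Y\<in>F. act (r Y) (w Y))"
      unfolding F(4) by (rule lincomb_coset) (use F w r in auto)
    then have "a - (\<Sum>Y\<in>F. act (r Y) (w Y)) \<in> D" by (simp add: coset_eq_iff)
    with F show ?thesis by blast
  qed
  moreover have "w ` X \<subseteq> A" using w by auto
  ultimately show ?thesis unfolding quot_basis_def by blast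
qed

lemma basis_of_quot_basis:
  assumes qb: "quot_basis act p A D I v"
  shows "inj_on (\<lambda>i. coset (v i)) I" "basis ((\<lambda>i. coset (v i)) ` I)"
proof -
  have vA: "\<And>i. i \<in> I \<Longrightarrow> v i \<in> A"
    and indep: "\<And>F r i. finite F \<Longrightarrow> F \<subseteq> I \<Longrightarrow> (\<Sum>i\<in>F. act (r i) (v i)) \<in> D \<Longrightarrow> i \<in> F \<Longrightarrow> p dvd r i"
    and spans: "\<And>a. a \<in> A \<Longrightarrow> \<exists>F r. finite F \<and> F \<subseteq> I \<and> a - (\<Sum>i\<in>F. act (r i) (v i)) \<in> D"
    using qb unfolding quot_basis_def by (auto simp: image_subset_iff)
  let ?c = "\<lambda>i. coset (v i)"
  let ?X = "?c ` I"
  show inj: "inj_on ?c I"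
  proof (rule inj_onI, rule ccontr)
    fix i j assume ij: "i \<in> I" "j \<in> I" "?c i = ?c j" "i \<noteq> j"
    \<comment> \<open>With coefficients 1 and -1 the difference of the two representatives lies in
      \<open>D\<close>, so \<open>p\<close> would divide 1, against 1 being nonzero in the field
      \<open>K\<close>.\<close>
    let ?r = "\<lambda>k. if k = i then 1 else - 1 :: 'r"
    have "(\<Sum>k\<in>{i, j}. act (?r k) (v k)) \<in> D"
      using ij by (simp add: coset_eq_iff)
    from indep[OF _ _ this, of i] have "p dvd 1" using ij by auto
    then show False using \<pi>_eq_zero[of 1] by (simp add: \<pi>_one)
  qed
  define w where "w = inv_into I ?c"
  have w: "w Y \<in> I" "coset (v (w Y)) = Y" if "Y \<in> ?X" for Y
    using that inv_into_into[of Y ?c I] f_inv_into_f[of Y ?c I] by (simp_all add: w_def)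
  have Xc: "?X \<subseteq> carrier M" using vA coset_in_carrier by auto
  have "lin_indpt ?X"
  proof
    assume "lin_dep ?X"
    then obtain F a Y where F: "finite F" "F \<subseteq> ?X" "a \<in> F \<rightarrow> carrier K"
        "lincomb a F = \<zero>\<^bsub>M\<^esub>" "Y \<in> F" "a Y \<noteq> \<zero>"
      unfolding lin_dep_def by blast
    have "\<forall>Y\<in>F. \<exists>r. a Y = \<pi> r" using F(3) \<pi>_surj by (auto simp: Pi_iff)
    then obtain r where r: "\<And>Y. Y \<in> F \<Longrightarrow> a Y = \<pi> (r Y)" by metis
    have inj_w: "inj_on w F" using F(2) w(2)
      by (intro inj_on_inverseI[of F ?c]) auto
    have "lincomb a F = coset (\<Sum>Y\<in>F. act (r Y) (v (w Y)))"
      using F(1,2) r w vA by (intro lincomb_coset) auto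
    also have "(\<Sum>Y\<in>F. act (r Y) (v (w Y))) = (\<Sum>i\<in>w ` F. act (r (?c i)) (v i))"
      unfolding sum.reindex[OF inj_w] o_def using F(2) w(2)
      by (intro sum.cong refl) (metis subsetD)
    finally have "(\<Sum>i\<in>w ` F. act (r (?c i)) (v i)) \<in> D"
      using F(4) coset_eq_zero by metis
    then have "p dvd r (?c (w Y))"
      by (rule indep[rotated 2]) (use F w in auto)
    then show False using F w(2)[of Y] r[of Y] \<pi>_eq_zero by auto
  qed
  moreover have "span ?X = carrier M"
  proof
    show "span ?X \<subseteq> carrier M" using Xc by (rule span_is_subset2)
    show "carrier M \<subseteq> span ?X"
    proof
      fix Y assume "Y \<in> carrier M"
      then obtain a where a: "a \<in> A" "Y = coset a" by (rule carrierE)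
      then obtain F r where F: "finite F" "F \<subseteq> I" "a - (\<Sum>i\<in>F. act (r i) (v i)) \<in> D"
        using spans by blast
      have inj_F: "inj_on ?c F" using inj F(2) by (rule inj_on_subset)
      have wF: "w (?c i) = i" if "i \<in> F" for i
        unfolding w_def using that F(2) inv_into_f_f[OF inj, of i] by blast
      let ?a = "\<lambda>Y. \<pi> (r (w Y))"
      have "lincomb ?a (?c ` F) = coset (\<Sum>Y\<in>?c ` F. act (r (w Y)) (v (w Y)))"
        by (rule lincomb_coset) (use F w vA in auto)
      also have "(\<Sum>Y\<in>?c ` F. act (r (w Y)) (v (w Y))) = (\<Sum>i\<in>F. act (r i) (v i))"
        unfolding sum.reindex[OF inj_F] o_def using wF by (intro sum.cong) simp_all
      also have "coset \<dots> = Y" using F a coset_eq_iff by metis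
      finally show "Y \<in> span ?X"
        unfolding span_def using F \<pi>_surj
        by (intro CollectI exI[of _ ?a] exI[of _ "?c ` F"]) auto
    qed
  qed
  ultimately show "basis ?X" unfolding basis_def using Xc by blast
qed

lemma dimension_basis: "\<exists>X. basis X \<and> dimension K M = |X|"
  using basis_exists unfolding dimension_def by (metis someI_ex)

lemma quot_basis_of_dimension:
  "\<exists>(I :: 'v set set) w. quot_basis act p A D I w \<and> dimension K M = |I|"
  using dimension_basis quot_basis_of_basis by metis

text \<open>Two bases are always equipotent, so the choice made inside \<open>dimension\<close> does
  not matter and every family of representatives computes it.\<close>

lemma dimension_ordIso_quot_basis:
  assumes "quot_basis act p A D I v"
  shows "dimension K M =o |I|"
proof -
  obtain X where X: "basis X" "dimension K M = |X|" using dimension_basis by blast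
  note b = basis_of_quot_basis[OF assms]
  have "|X| =o |(\<lambda>i. coset (v i)) ` I|" using X(1) b(2) by (rule basis_card_of_ordIso)
  also have "|(\<lambda>i. coset (v i)) ` I| =o |I|"
    using b(1) card_of_ordIsoI ordIso_symmetric inj_on_imp_bij_betw by metis
  finally show ?thesis by (simp add: X(2))
qed

end

subsection \<open>Cyclic decompositions of primary modules\<close>

locale ring_action = Modules.module act
  for act :: "'a::comm_ring_1 \<Rightarrow> 'b::ab_group_add \<Rightarrow> 'b" (infixr \<open>*s\<close> 75)
begin

definition pker :: "'a \<Rightarrow> nat \<Rightarrow> 'b set" where
  "pker p s = {v. p ^ s *s v = 0}"

text \<open>Take \<open>s\<close> \<ge> 1, an irreducible polynomial \<open>p\<close> and a cyclic
  module with annihilator (p^t). Then \<open>pker p s\<close> modulo this submodule is the residue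
  field if s = t and zero otherwise: for t < s the first summand is already everything, for t > s
  the second one is all of \<open>pker p s\<close>. The quotient thus counts the cyclic summands of
  order exactly \<open>s\<close>.\<close>

definition psub :: "'a \<Rightarrow> nat \<Rightarrow> 'b set" where
  "psub p s = {a + p *s b | a b. a \<in> pker p (s - 1) \<and> b \<in> pker p (s + 1)}"

lemma subspace_pker: "subspace (pker p s)"
  by (rule subspaceI) (simp_all add: pker_def scale_right_distrib scale_left_commute[of "p ^ s"] del: scale_scale)

lemma pker_mono: "s \<le> t \<Longrightarrow> pker p s \<subseteq> pker p t"
proof
  fix v assume "s \<le> t" "v \<in> pker p s"
  moreover have "p ^ t = p ^ (t - s) * p ^ s" using \<open>s \<le> t\<close> by (simp flip: power_add)
  ultimately show "v \<in> pker p t" by (simp add: pker_def flip: scale_scale)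
qed

lemma scale_pker: "v \<in> pker p (s + j) \<Longrightarrow> p ^ j *s v \<in> pker p s"
  by (simp add: pker_def power_add)

lemma pker_Suc: "p *s v \<in> pker p s \<longleftrightarrow> v \<in> pker p (Suc s)"
  by (simp add: pker_def mult.commute)

lemma subspace_psub: "subspace (psub p s)"
proof (rule subspaceI)
  show "0 \<in> psub p s"
    unfolding psub_def
    by (intro CollectI exI[of _ 0]) (simp add: subspace_0[OF subspace_pker])
next
  fix x y assume "x \<in> psub p s" "y \<in> psub p s"
  then obtain a b c d where "x = a + p *s b" "y = c + p *s d"
      "a \<in> pker p (s - 1)" "b \<in> pker p (s + 1)" "c \<in> pker p (s - 1)" "d \<in> pker p (s + 1)"
    unfolding psub_def by blast
  then show "x + y \<in> psub p s"
    unfolding psub_def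
    by (intro CollectI exI[of _ "a + c"] exI[of _ "b + d"])
      (simp add: algebra_simps subspace_add[OF subspace_pker])
next
  fix c x assume "x \<in> psub p s"
  then obtain a b where "x = a + p *s b" "a \<in> pker p (s - 1)" "b \<in> pker p (s + 1)"
    unfolding psub_def by blast
  then show "c *s x \<in> psub p s"
    unfolding psub_def
    by (intro CollectI exI[of _ "c *s a"] exI[of _ "c *s b"])
      (simp add: algebra_simps subspace_scale[OF subspace_pker])
qed

lemma psub_subset_pker: "psub p s \<subseteq> pker p s"
proof
  fix x assume "x \<in> psub p s"
  then obtain a b where "x = a + p *s b" "a \<in> pker p (s - 1)" "b \<in> pker p (s + 1)"
    unfolding psub_def by blast
  then show "x \<in> pker p s"
    using pker_mono[of "s - 1" s p] pker_Suc[of p b s] subspace_add[OF subspace_pker] by auto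
qed

text \<open>This is what makes the quotient a module over the residue ring of
  \<open>p\<close>.\<close>

lemma scale_pker_in_psub: "v \<in> pker p s \<Longrightarrow> p *s v \<in> psub p s"
  unfolding psub_def using pker_mono[of s "s + 1" p]
  by (intro CollectI exI[of _ 0] exI[of _ v]) (auto simp: subspace_0[OF subspace_pker])

text \<open>Used contrapositively: a nonempty basis of the quotient forces the kernels to grow
  strictly at \<open>s\<close>, which bounds the orders that occur.\<close>

lemma psub_eq_pker:
  assumes "pker p s \<subseteq> pker p (s - 1)"
  shows "psub p s = pker p s"
proof
  show "pker p s \<subseteq> psub p s"
  proof
    fix v assume "v \<in> pker p s"
    then show "v \<in> psub p s"
      unfolding psub_def using assms
      by (intro CollectI exI[of _ v] exI[of _ 0]) (auto simp: subspace_0[OF subspace_pker])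
  qed
qed (rule psub_subset_pker)

lemma span_image_sumE:
  assumes "x \<in> span (f ` I)"
  obtains F r where "finite F" "F \<subseteq> I" "x = (\<Sum>i\<in>F. r i *s f i)"
proof -
  have "\<exists>F r. finite F \<and> F \<subseteq> I \<and> x = (\<Sum>i\<in>F. r i *s f i)"
    using assms
  proof (induction rule: span_induct_alt)
    case base
    show ?case by (intro exI[of _ "{}"]) simp
  next
    case (step c y z)
    then obtain k F r where k: "k \<in> I" "y = f k" and F: "finite F" "F \<subseteq> I" "z = (\<Sum>i\<in>F. r i *s f i)"
      by blast
    \<comment> \<open>The index \<open>k\<close> may already occur in \<open>F\<close>, so its new
      coefficient is added to the old one.\<close>
    define r' where "r' = (\<lambda>i. (if i = k then c else 0) + (if i \<in> F then r i else 0))"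
    have "(\<Sum>i\<in>insert k F. r' i *s f i) =
        (\<Sum>i\<in>insert k F. if i = k then c *s f i else 0) + (\<Sum>i\<in>insert k F. if i \<in> F then r i *s f i else 0)"
      unfolding sum.distrib[symmetric]
      by (rule sum.cong) (auto simp: r'_def scale_left_distrib)
    also have "(\<Sum>i\<in>insert k F. if i = k then c *s f i else 0) = c *s y"
      using F(1) k(2) by simp
    also have "(\<Sum>i\<in>insert k F. if i \<in> F then r i *s f i else 0) = z"
      unfolding F(3) using F(1) by (intro sum.mono_neutral_cong_right) auto
    finally have "c *s y + z = (\<Sum>i\<in>insert k F. r' i *s f i)" by simp
    then show ?case using k F by (intro exI[of _ "insert k F"] exI[of _ r']) auto
  qed
  then show ?thesis using that by blast
qed

lemma sum_mem_span_image: "F \<subseteq> I \<Longrightarrow> (\<Sum>i\<in>F. r i *s f i) \<in> span (f ` I)"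
  by (intro span_sum span_scale span_base) auto

text \<open>
  Descending induction on the order: once the coefficients of order greater than \<open>s\<close> are divisible
  by \<open>p\<close>, the terms of order \<open>s\<close> add up to an element of \<open>psub p s\<close>.
\<close>

lemma primary_step:
  assumes J: "finite J"
    and mem: "\<And>j. j \<in> J \<Longrightarrow> u j \<in> pker p (ord j)"
    and indep: "\<And>s r j. 1 \<le> s \<Longrightarrow> (\<Sum>j\<in>{j\<in>J. ord j = s}. r j *s u j) \<in> psub p s \<Longrightarrow>
      j \<in> J \<Longrightarrow> ord j = s \<Longrightarrow> p dvd r j"
    and y: "(\<Sum>j\<in>{j\<in>J. t < ord j}. r j *s u j) \<in> pker p t"
    and j: "j \<in> J" "t < ord j"
  shows "p dvd r j"
  using j
proof (induction "Max (ord ` J) - ord j" arbitrary: j rule: less_induct)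
  case less
  define s where "s = ord j"
  have t: "t \<le> s - 1" "1 \<le> s" using less.prems by (simp_all add: s_def)
  define Hi Lo Eq where "Hi = {k\<in>J. s < ord k}" and "Lo = {k\<in>J. t < ord k \<and> ord k < s}"
    and "Eq = {k\<in>J. ord k = s}"
  have fin: "finite Hi" "finite Lo" "finite Eq" using J by (auto simp: Hi_def Lo_def Eq_def)
  have "p dvd r k" if "k \<in> Hi" for k
  proof (rule less.hyps)
    have "ord k \<le> Max (ord ` J)" using that J by (auto simp: Hi_def)
    then show "Max (ord ` J) - ord k < Max (ord ` J) - ord j"
      using that by (auto simp: Hi_def s_def)
  qed (use that t in \<open>auto simp: Hi_def\<close>)
  then have "\<forall>k\<in>Hi. \<exists>c. r k = p * c" by (simp add: dvd_def)
  then obtain c where c: "\<And>k. k \<in> Hi \<Longrightarrow> r k = p * c k" by metis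
  define z where "z = (\<Sum>k\<in>Hi. c k *s u k)"
  let ?f = "\<lambda>k. r k *s u k"
  have Hi: "sum ?f Hi = p *s z"
    unfolding z_def scale_sum_right by (rule sum.cong) (simp_all add: c)
  have "{k\<in>J. t < ord k} = Hi \<union> (Eq \<union> Lo)" using t by (auto simp: Hi_def Lo_def Eq_def)
  moreover have "Hi \<inter> (Eq \<union> Lo) = {}" "Eq \<inter> Lo = {}" by (auto simp: Hi_def Lo_def Eq_def)
  ultimately have split: "sum ?f {k\<in>J. t < ord k} = p *s z + (sum ?f Eq + sum ?f Lo)"
    using fin by (simp add: sum.union_disjoint Hi)
  have "sum ?f {k\<in>J. t < ord k} \<in> pker p (s - 1)"
    using y pker_mono[OF t(1)] by blast
  moreover have Lo: "sum ?f Lo \<in> pker p (s - 1)"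
  proof (intro subspace_sum[OF subspace_pker] subspace_scale[OF subspace_pker])
    fix k assume k: "k \<in> Lo"
    then have "ord k \<le> s - 1" by (auto simp: Lo_def)
    then show "u k \<in> pker p (s - 1)"
      using mem[of k] pker_mono[of "ord k" "s - 1" p] k by (auto simp: Lo_def)
  qed
  ultimately have d: "sum ?f {k\<in>J. t < ord k} - sum ?f Lo \<in> pker p (s - 1)"
    by (rule subspace_diff[OF subspace_pker])
  have Eq: "sum ?f Eq \<in> pker p s"
    by (intro subspace_sum[OF subspace_pker] subspace_scale[OF subspace_pker])
      (use mem in \<open>auto simp: Eq_def\<close>)
  \<comment> \<open>Once \<open>p *s z\<close> is known to be killed by p^s, \<open>z\<close> lies
    in \<open>pker p (s + 1)\<close>, as the second term of \<open>psub p s\<close>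
    requires.\<close>
  have "p *s z = (sum ?f {k\<in>J. t < ord k} - sum ?f Lo) - sum ?f Eq"
    using split by (simp add: algebra_simps)
  also have "\<dots> \<in> pker p s"
    using d pker_mono[of "s - 1" s p] by (intro subspace_diff[OF subspace_pker _ Eq]) auto
  finally have "z \<in> pker p (s + 1)" by (simp add: pker_Suc)
  moreover have "sum ?f Eq = (sum ?f {k\<in>J. t < ord k} - sum ?f Lo) + p *s (- z)"
    using split by (simp add: algebra_simps)
  ultimately have "sum ?f Eq \<in> psub p s"
    unfolding psub_def using d subspace_neg[OF subspace_pker, of z p "s + 1"]
    by (intro CollectI exI conjI)
  then show ?case
    unfolding Eq_def by (rule indep[OF t(2) _ less.prems(1) s_def[symmetric]])
qed

text \<open>Suppose that each coefficient is divisible by p^t or already kills its term. The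
  relation divided by p^t is then killed by p^t, and \<open>primary_step\<close> yields one more
  factor \<open>p\<close> for all orders above \<open>t\<close>.\<close>

lemma primary_independent:
  assumes J: "finite J"
    and mem: "\<And>j. j \<in> J \<Longrightarrow> u j \<in> pker p (ord j)"
    and indep: "\<And>s r j. 1 \<le> s \<Longrightarrow> (\<Sum>j\<in>{j\<in>J. ord j = s}. r j *s u j) \<in> psub p s \<Longrightarrow>
      j \<in> J \<Longrightarrow> ord j = s \<Longrightarrow> p dvd r j"
    and zero: "(\<Sum>j\<in>J. r j *s u j) = 0"
    and j: "j \<in> J"
  shows "p ^ ord j dvd r j"
proof -
  \<comment> \<open>Truncating the exponent at \<open>ord j\<close> lets one induction on
    \<open>t\<close> serve all orders at once.\<close>
  have "\<forall>j\<in>J. p ^ min t (ord j) dvd r j" for t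
  proof (induction t)
    case (Suc t)
    then obtain c where c: "\<And>k. k \<in> J \<Longrightarrow> r k = p ^ min t (ord k) * c k"
      unfolding dvd_def by metis
    define J' where "J' = {k\<in>J. t < ord k}"
    have r0: "r k *s u k = 0" if "k \<in> J - J'" for k
    proof -
      have "min t (ord k) = ord k" using that by (auto simp: J'_def)
      then have "r k = c k * p ^ ord k" using that c[of k] by (simp add: mult.commute)
      then show ?thesis using mem[of k] that by (simp add: pker_def flip: scale_scale)
    qed
    have "p ^ t *s (\<Sum>k\<in>J'. c k *s u k) = (\<Sum>k\<in>J'. r k *s u k)"
      unfolding scale_sum_right by (rule sum.cong) (simp_all add: J'_def c)
    also have "\<dots> = (\<Sum>k\<in>J. r k *s u k)"
      by (rule sum.mono_neutral_left) (use J r0 in \<open>auto simp: J'_def\<close>)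
    finally have "(\<Sum>k\<in>J'. c k *s u k) \<in> pker p t" by (simp add: pker_def zero)
    then have y: "(\<Sum>k\<in>{k\<in>J. t < ord k}. c k *s u k) \<in> pker p t" by (simp add: J'_def)
    have p: "p dvd c k" if "k \<in> J'" for k
    proof (rule primary_step[where J = J and u = u and ord = ord and t = t and r = c])
      show "p dvd r j" if "1 \<le> s" "(\<Sum>j\<in>{j\<in>J. ord j = s}. r j *s u j) \<in> psub p s" "j \<in> J" "ord j = s"
        for s r j
        using that by (rule indep)
    qed (use that J mem y in \<open>auto simp: J'_def\<close>)
    show ?case
    proof
      fix k assume k: "k \<in> J"
      show "p ^ min (Suc t) (ord k) dvd r k"
      proof (cases "k \<in> J'")
        case True
        then have "r k = p ^ t * c k" using c[OF k] by (simp add: J'_def)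
        then have "p ^ Suc t dvd r k" using mult_dvd_mono[OF dvd_refl p[OF True], of "p ^ t"]
          by (simp add: mult.commute)
        then show ?thesis using power_le_dvd min.cobounded1 by blast
      next
        case False
        then have "min (Suc t) (ord k) = min t (ord k)" using k by (auto simp: J'_def)
        then show ?thesis using bspec[OF Suc k] by (simp only:)
      qed
    qed
  qed simp
  then have "p ^ min (ord j) (ord j) dvd r j" using j by blast
  then show ?thesis by simp
qed

text \<open>In an error from \<open>psub\<close>, the term in \<open>pker p (s - 1)\<close> is
  absorbed by induction on \<open>s\<close>, and the multiple of \<open>p\<close> by iteration up to
  the exponent \<open>N\<close>. Without a bound generation can fail: on k[x, 1/x] / k[x] with p = x
  all quotients vanish, although the module is not zero.\<close>

lemma primary_subset:
  assumes S: "subspace S"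
    and gen: "\<And>s a. 1 \<le> s \<Longrightarrow> a \<in> pker p s \<Longrightarrow> \<exists>y\<in>S. a - y \<in> psub p s"
    and bound: "\<And>s. pker p s \<subseteq> pker p N"
  shows "pker p s \<subseteq> S"
proof (induction s)
  case 0
  then show ?case using subspace_0[OF S] by (auto simp: pker_def)
next
  case (Suc s)
  \<comment> \<open>Iterating \<open>gen\<close> pushes the error into \<open>p ^ j\<close> times the module, which vanishes for \<open>j = N\<close>.\<close>
  have approx: "\<exists>w\<in>pker p (Suc s + j). a - p ^ j *s w \<in> S" if a: "a \<in> pker p (Suc s)" for a j
  proof (induction j)
    case 0
    then show ?case using a subspace_0[OF S] by (intro bexI[of _ a]) simp_all
  next
    case (Suc j)
    then obtain w where w: "w \<in> pker p (Suc s + j)" "a - p ^ j *s w \<in> S" by blast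
    then obtain y where y: "y \<in> S" "w - y \<in> psub p (Suc s + j)" using gen by fastforce
    then obtain b z where bz: "w - y = b + p *s z" "b \<in> pker p (s + j)" "z \<in> pker p (Suc s + Suc j)"
      unfolding psub_def by auto
    have "p ^ j *s b \<in> S" using scale_pker[OF bz(2)] \<open>pker p s \<subseteq> S\<close> by blast
    moreover have "p ^ j *s y \<in> S" using y(1) subspace_scale[OF S] by blast
    moreover have "a - p ^ Suc j *s z = (a - p ^ j *s w) + (p ^ j *s y + p ^ j *s b)"
    proof -
      have "w = y + b + p *s z" using bz(1) by (simp add: algebra_simps)
      then show ?thesis by (simp add: scale_right_distrib mult.commute)
    qed
    ultimately have "a - p ^ Suc j *s z \<in> S" using w(2) subspace_add[OF S] by presburger
    then show ?case using bz(3) by blast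
  qed
  show ?case
  proof
    fix a assume "a \<in> pker p (Suc s)"
    then obtain w where "w \<in> pker p (Suc s + N)" "a - p ^ N *s w \<in> S" using approx by blast
    moreover from this(1) have "w \<in> pker p N" using bound by blast
    then have "p ^ N *s w = 0" by (simp add: pker_def)
    ultimately show "a \<in> S" by simp
  qed
qed

text \<open>
  The sum of the submodules generated by the \<open>v i\<close> is direct and the annihilator of \<open>v i\<close> is
  generated by \<open>a i\<close>.
\<close>

definition cyclic_independent :: "'i set \<Rightarrow> ('i \<Rightarrow> 'b) \<Rightarrow> ('i \<Rightarrow> 'a) \<Rightarrow> bool" where
  "cyclic_independent I v a \<longleftrightarrow>
     (\<forall>i\<in>I. a i *s v i = 0) \<and>
     (\<forall>F r. finite F \<longrightarrow> F \<subseteq> I \<longrightarrow> (\<Sum>i\<in>F. r i *s v i) = 0 \<longrightarrow> (\<forall>i\<in>F. a i dvd r i))"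

lemma cyclic_independent_iff:
  assumes "cyclic_independent I v a" "finite F" "F \<subseteq> I"
  shows "(\<Sum>i\<in>F. r i *s v i) = 0 \<longleftrightarrow> (\<forall>i\<in>F. a i dvd r i)"
proof
  assume "\<forall>i\<in>F. a i dvd r i"
  then have "r i *s v i = 0" if "i \<in> F" for i
    using that assms(1,3) unfolding cyclic_independent_def dvd_def
    by (metis mult.commute scale_scale scale_zero_right subsetD)
  then show "(\<Sum>i\<in>F. r i *s v i) = 0" by simp
qed (use assms in \<open>auto simp: cyclic_independent_def\<close>)

lemma cyclic_independent_reindex:
  assumes "cyclic_independent I v a" "inj_on g J" "g ` J \<subseteq> I"
  shows "cyclic_independent J (\<lambda>i. v (g i)) (\<lambda>i. a (g i))"
  unfolding cyclic_independent_def
proof (intro conjI allI impI ballI)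
  fix i assume "i \<in> J"
  then show "a (g i) *s v (g i) = 0" using assms by (auto simp: cyclic_independent_def)
next
  fix F r i assume F: "finite F" "F \<subseteq> J" "(\<Sum>i\<in>F. r i *s v (g i)) = 0" and i: "i \<in> F"
  have inj: "inj_on g F" using assms(2) F(2) by (rule inj_on_subset)
  have "(\<Sum>k\<in>g ` F. r (inv_into F g k) *s v k) = (\<Sum>i\<in>F. r i *s v (g i))"
    unfolding sum.reindex[OF inj] by (rule sum.cong) (simp_all add: inv_into_f_f[OF inj])
  then have "(\<Sum>k\<in>g ` F. r (inv_into F g k) *s v k) = 0" using F(3) by simp
  moreover have "finite (g ` F)" "g ` F \<subseteq> I" using F assms(3) by auto
  ultimately have "\<forall>k\<in>g ` F. a k dvd r (inv_into F g k)"
    by (simp only: cyclic_independent_iff[OF assms(1)])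
  then have "a (g i) dvd r (inv_into F g (g i))" using i by (rule bspec[OF _ imageI])
  then show "a (g i) dvd r i" by (simp add: inv_into_f_f[OF inj i])
qed

end

text \<open>A combination vanishes exactly when each \<open>a i\<close> divides its coefficient, so
  the two families satisfy the same relations. Spanning the pairs of generators in the product
  module avoids any choice of coefficients for a vector.\<close>

lemma cyclic_family_hom:
  fixes act :: "'r::comm_ring_1 \<Rightarrow> 'v::ab_group_add \<Rightarrow> 'v"
    and act' :: "'r \<Rightarrow> 'w::ab_group_add \<Rightarrow> 'w"
  assumes "ring_action act" "ring_action act'"
    and ind: "ring_action.cyclic_independent act I v a"
    and ind': "ring_action.cyclic_independent act' I v' a"
    and gen: "Modules.module.span act (v ` I) = UNIV"
  shows "\<exists>\<tau>. (\<forall>x y. \<tau> (x + y) = \<tau> x + \<tau> y) \<and> (\<forall>r x. \<tau> (act r x) = act' r (\<tau> x)) \<and>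
    inj \<tau> \<and> range \<tau> = Modules.module.span act' (v' ` I)"
proof -
  interpret A: ring_action act by fact
  interpret B: ring_action act' by fact
  define act2 where "act2 r xy = (act r (fst xy), act' r (snd xy))" for r xy
  interpret AB: ring_action act2
    by unfold_locales (simp_all add: act2_def A.scale_right_distrib A.scale_left_distrib
        B.scale_right_distrib B.scale_left_distrib prod_eq_iff)
  \<comment> \<open>\<open>G\<close> is the graph of the homomorphism to be constructed.\<close>
  define G where "G = AB.span ((\<lambda>i. (v i, v' i)) ` I)"
  have sub: "AB.subspace G" by (simp add: G_def)
  have sum2: "(\<Sum>i\<in>F. act2 (r i) (v i, v' i)) = (\<Sum>i\<in>F. act (r i) (v i), \<Sum>i\<in>F. act' (r i) (v' i))" for F r
    by (induction F rule: infinite_finite_induct) (simp_all add: act2_def zero_prod_def)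
  have memG: "(\<Sum>i\<in>F. act (r i) (v i), \<Sum>i\<in>F. act' (r i) (v' i)) \<in> G" if "F \<subseteq> I" for F r
    using AB.sum_mem_span_image[OF that, of r "\<lambda>i. (v i, v' i)"] by (simp add: G_def sum2)
  have Gex: "\<exists>F r. finite F \<and> F \<subseteq> I \<and> x = (\<Sum>i\<in>F. act (r i) (v i)) \<and> y = (\<Sum>i\<in>F. act' (r i) (v' i))"
    if "(x, y) \<in> G" for x y
    using that unfolding G_def by (elim AB.span_image_sumE) (auto simp: sum2)
  \<comment> \<open>One direction makes \<open>G\<close> single-valued, the other makes the
    resulting map injective.\<close>
  have zero: "x = 0 \<longleftrightarrow> y = 0" if "(x, y) \<in> G" for x y
    using Gex[OF that] ind ind' by (auto simp: A.cyclic_independent_iff B.cyclic_independent_iff)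
  have total: "\<exists>y. (x, y) \<in> G" for x
  proof -
    have "x \<in> A.span (v ` I)" by (simp add: gen)
    then show ?thesis by (elim A.span_image_sumE) (use memG in blast)
  qed
  have diff: "(x - z, y - w) \<in> G" if "(x, y) \<in> G" "(z, w) \<in> G" for x y z w
    using AB.subspace_diff[OF sub that] by simp
  define \<tau> where "\<tau> x = (SOME y. (x, y) \<in> G)" for x
  have \<tau>G: "(x, \<tau> x) \<in> G" for x unfolding \<tau>_def using total by (rule someI_ex)
  have \<tau>I: "\<tau> x = y" if "(x, y) \<in> G" for x y
    using zero[OF diff[OF \<tau>G[of x] that]] by simp
  show ?thesis
  proof (intro exI[of _ \<tau>] conjI allI)
    show "\<tau> (x + y) = \<tau> x + \<tau> y" for x y
      using AB.subspace_add[OF sub \<tau>G \<tau>G, of x y] by (intro \<tau>I) simp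
    show "\<tau> (act r x) = act' r (\<tau> x)" for r x
      using AB.subspace_scale[OF sub \<tau>G, of r x] by (intro \<tau>I) (simp add: act2_def)
    show "inj \<tau>"
    proof (rule injI)
      fix x y assume "\<tau> x = \<tau> y"
      then show "x = y" using zero[OF diff[OF \<tau>G \<tau>G, of x y]] by simp
    qed
    show "range \<tau> = B.span (v' ` I)"
    proof
      show "range \<tau> \<subseteq> B.span (v' ` I)"
      proof
        fix y assume "y \<in> range \<tau>"
        then obtain x where "y = \<tau> x" by blast
        then obtain F r where "F \<subseteq> I" "y = (\<Sum>i\<in>F. act' (r i) (v' i))" using Gex[OF \<tau>G[of x]] by blast
        then show "y \<in> B.span (v' ` I)" by (simp add: B.sum_mem_span_image)
      qed
      show "B.span (v' ` I) \<subseteq> range \<tau>"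
      proof
        fix y assume "y \<in> B.span (v' ` I)"
        then obtain F r where "F \<subseteq> I" "y = (\<Sum>i\<in>F. act' (r i) (v' i))" by (rule B.span_image_sumE)
        then show "y \<in> range \<tau>" using \<tau>I[OF memG[of F r]] by (metis rangeI)
      qed
    qed
  qed
qed

subsection \<open>The action of polynomials through an endomorphism\<close>

text \<open>An ideal properly above (p) contains some \<open>q\<close> not divisible by
  \<open>p\<close>, and hence 1 by a Bezout identity for \<open>p\<close> and
  \<open>q\<close>.\<close>

lemma residue_field_field:
  fixes p :: "'k::field poly"
  assumes p: "irreducible p"
  shows "field (residue_field p)"
proof -
  let ?R = "class_ring :: 'k poly ring"
  have R: "cring ?R" ..
  have mem: "q \<in> PIdl\<^bsub>?R\<^esub> p \<longleftrightarrow> p dvd q" for q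
    by (auto simp: cgenideal_def dvd_def mult.commute)
  interpret I: ideal "PIdl\<^bsub>?R\<^esub> p" ?R
    by (rule cring.cgenideal_ideal[OF R]) simp
  have "maximalideal (PIdl\<^bsub>?R\<^esub> p) ?R"
  proof (rule maximalidealI)
    show "ideal (PIdl\<^bsub>?R\<^esub> p) ?R" by (rule I.ideal_axioms)
    have "1 \<notin> PIdl\<^bsub>?R\<^esub> p" using p by (simp add: mem irreducible_def)
    then show "carrier ?R \<noteq> PIdl\<^bsub>?R\<^esub> p" by auto
    fix J assume J: "ideal J ?R" "PIdl\<^bsub>?R\<^esub> p \<subseteq> J" "J \<subseteq> carrier ?R"
    interpret J: ideal J ?R by (rule J(1))
    show "J = PIdl\<^bsub>?R\<^esub> p \<or> J = carrier ?R"
    proof (cases "J \<subseteq> PIdl\<^bsub>?R\<^esub> p")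
      case False
      then obtain q where q: "q \<in> J" "\<not> p dvd q" using mem by blast
      obtain x y where "x * p + y * q = 1"
        using irreducible_comaximal[OF p q(2)] by (auto simp: comaximal_def)
      moreover have "p \<in> PIdl\<^bsub>?R\<^esub> p" by (simp add: mem)
      then have "p \<in> J" using J(2) by (rule subsetD[rotated])
      then have "x * p \<in> J" "y * q \<in> J"
        using q J.I_l_closed[of p x] J.I_l_closed[of q y] by simp_all
      then have "x * p + y * q \<in> J" using J.a_closed[of "x * p" "y * q"] by simp
      ultimately have "\<one>\<^bsub>?R\<^esub> \<in> J" by simp
      then show ?thesis using J.one_imp_carrier by blast
    qed (use J in auto)
  qed
  then show ?thesis
    unfolding residue_field_def by (rule maximalideal.quotient_is_field) (rule R)
qed

locale poly_action =
  fixes scale :: "'k::field \<Rightarrow> 'v::ab_group_add \<Rightarrow> 'v" and T :: "'v \<Rightarrow> 'v"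
  assumes vs: "vector_space scale" and lin: "Vector_Spaces.linear scale scale T"
begin

sublocale V: vector_space scale by (rule vs)
sublocale T: Vector_Spaces.linear scale scale T by (rule lin)

abbreviation act :: "'k poly \<Rightarrow> 'v \<Rightarrow> 'v" where
  "act q \<equiv> poly_endo scale q T"

lemma act_bound:
  assumes "degree q \<le> N"
  shows "act q v = (\<Sum>i\<le>N. scale (coeff q i) ((T ^^ i) v))"
  unfolding poly_endo_def
  by (rule sum.mono_neutral_left) (use assms in \<open>auto simp: coeff_eq_0\<close>)

text \<open>Horner's recursion; the rules of the action follow from it by induction on the
  polynomial.\<close>

lemma act_pCons: "act (pCons a q) v = scale a v + T (act q v)"
proof -
  have "act (pCons a q) v = (\<Sum>i\<le>Suc (degree q). scale (coeff (pCons a q) i) ((T ^^ i) v))"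
    by (rule act_bound) (simp add: degree_pCons_le)
  also have "\<dots> = scale a v + (\<Sum>i\<le>degree q. scale (coeff q i) (T ((T ^^ i) v)))"
    by (subst sum.atMost_Suc_shift) simp
  also have "(\<Sum>i\<le>degree q. scale (coeff q i) (T ((T ^^ i) v))) = T (act q v)"
    unfolding poly_endo_def by (simp add: T.sum T.scale)
  finally show ?thesis .
qed

lemma act_0 [simp]: "act 0 v = 0"
  by (simp add: poly_endo_def)

lemma act_add_left: "act (q + r) v = act q v + act r v"
  by (induction q r rule: poly_induct2) (simp_all add: act_pCons V.scale_left_distrib T.add)

lemma act_add_right: "act q (v + w) = act q v + act q w"
  by (induction q) (simp_all add: act_pCons V.scale_right_distrib T.add)

lemma act_scale_right: "act q (scale c v) = scale c (act q v)"
  by (induction q) (simp_all add: act_pCons V.scale_right_distrib T.scale mult.commute)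

lemma act_T_right: "act q (T v) = T (act q v)"
  by (induction q) (simp_all add: act_pCons T.add T.scale T.zero)

lemma act_smult: "act (Polynomial.smult c q) v = scale c (act q v)"
  by (induction q) (simp_all add: act_pCons V.scale_right_distrib T.scale)

lemma act_mult: "act (q * r) v = act q (act r v)"
  by (induction q) (simp_all add: act_pCons act_add_left act_smult)

lemma act_const: "act [:c:] v = scale c v"
  by (simp add: act_pCons T.zero)

lemma act_x: "act [:0, 1:] v = T v"
  by (simp add: act_pCons T.zero)

lemma module_act: "Modules.module act"
  by unfold_locales
    (simp_all add: act_add_left act_add_right act_mult act_const flip: pCons_one)

sublocale P: ring_action act by (intro ring_action.intro module_act)

lemma act_pow: "(act q ^^ n) v = act (q ^ n) v"
  by (induction n arbitrary: v) simp_all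

lemma T_pow: "(T ^^ n) v = act ([:0, 1:] ^ n) v"
proof -
  have "act [:0, 1:] = T" by (auto simp: act_x)
  then show ?thesis using act_pow[where q = "[:0, 1:]"] by simp
qed

end

section \<open>Kernel quotients as vector spaces over the residue field and over the base
  field\<close>

context poly_action
begin

text \<open>
  The index set \<open>S\<close> is a residue class for \<open>residue_space\<close> and a singleton for \<open>quotient_module\<close>.
\<close>

lemma quotient_module_smult:
  assumes A: "P.subspace A" and D: "P.subspace D" and w: "w \<in> A" and q: "q \<in> S"
    and cong: "\<And>r x. r \<in> S \<Longrightarrow> x \<in> A \<Longrightarrow> f r x - act q x \<in> D" and fD: "\<And>r b. r \<in> S \<Longrightarrow> b \<in> D \<Longrightarrow> f r b \<in> D"
    and DA: "D \<subseteq> A"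
  shows "(\<Union>r\<in>S. {f r x + b | x b. x \<in> {w + b | b. b \<in> D} \<and> b \<in> D}) = {act q w + b | b. b \<in> D}"
proof (intro equalityI subsetI)
  fix z assume "z \<in> (\<Union>r\<in>S. {f r x + b | x b. x \<in> {w + b | b. b \<in> D} \<and> b \<in> D})"
  then obtain r d b where z: "z = f r (w + d) + b" "r \<in> S" "d \<in> D" "b \<in> D" by blast
  have "w + d \<in> A" using w z DA P.subspace_add[OF A] by blast
  then have "f r (w + d) - act q (w + d) \<in> D" using cong z by blast
  moreover have "act q d \<in> D" using z P.subspace_scale[OF D] by blast
  ultimately have "(f r (w + d) - act q (w + d)) + (act q d + b) \<in> D"
    using z P.subspace_add[OF D] by blast
  moreover have "z = act q w + ((f r (w + d) - act q (w + d)) + (act q d + b))"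
    by (simp add: z act_add_right)
  ultimately show "z \<in> {act q w + b | b. b \<in> D}" by blast
next
  fix z assume "z \<in> {act q w + b | b. b \<in> D}"
  then obtain b where b: "z = act q w + b" "b \<in> D" by blast
  have "b - (f q w - act q w) \<in> D" using b cong[OF q w] P.subspace_diff[OF D] by blast
  moreover have "z = f q (w + 0) + (b - (f q w - act q w))" by (simp add: b)
  ultimately show "z \<in> (\<Union>r\<in>S. {f r x + b | x b. x \<in> {w + b | b. b \<in> D} \<and> b \<in> D})"
    using q P.subspace_0[OF D] by blast
qed

text \<open>Representatives of one residue class differ by a multiple of \<open>q\<close>, and by
  \<open>qA\<close> such a multiple maps \<open>A\<close> into \<open>D\<close>. They therefore act
  alike on A / D, and the union in \<open>residue_space\<close> is a single coset.\<close>

lemma coset_space_residue: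
  assumes q: "irreducible q"
    and A: "P.subspace A" and D: "P.subspace D" and DA: "D \<subseteq> A"
    and qA: "\<And>v. v \<in> A \<Longrightarrow> act q v \<in> D"
  shows "coset_space act q A D (residue_field q) (\<lambda>r. PIdl\<^bsub>class_ring\<^esub> q +>\<^bsub>class_ring\<^esub> r)
    (residue_space (quotient_module act A D))"
proof -
  let ?R = "class_ring :: 'k poly ring"
  have R: "cring ?R" ..
  let ?I = "PIdl\<^bsub>?R\<^esub> q"
  let ?\<pi> = "\<lambda>r. ?I +>\<^bsub>?R\<^esub> r"
  have mem: "r \<in> ?I \<longleftrightarrow> q dvd r" for r
    by (auto simp: cgenideal_def dvd_def mult.commute)
  interpret I: ideal ?I ?R by (rule cring.cgenideal_ideal[OF R]) simp
  have hom: "?\<pi> \<in> Ring.ring_hom ?R (residue_field q)"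
    unfolding residue_field_def by (rule I.rcos_ring_hom)
  have cos: "?\<pi> r = {t. q dvd t - r}" for r
  proof -
    have "?\<pi> r = {i + r | i. q dvd i}" by (auto simp: a_r_coset_def' mem)
    also have "\<dots> = {t. q dvd t - r}" by (auto intro: exI[of _ "_ - r"])
    finally show ?thesis .
  qed
  show ?thesis
  proof (intro coset_space.intro[OF P.module_axioms] coset_space_axioms.intro)
    show "field (residue_field q)" using q by (rule residue_field_field)
    show "range ?\<pi> = carrier (residue_field q)"
      by (auto simp: residue_field_def FactRing_def A_RCOSETS_def')
    show "?\<pi> (a + b) = ?\<pi> a \<oplus>\<^bsub>residue_field q\<^esub> ?\<pi> b" for a b
      using ring_hom_add[OF hom, of a b] by simp
    show "?\<pi> (a * b) = ?\<pi> a \<otimes>\<^bsub>residue_field q\<^esub> ?\<pi> b" for a b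
      using ring_hom_mult[OF hom, of a b] by simp
    show "?\<pi> 1 = \<one>\<^bsub>residue_field q\<^esub>"
      using ring_hom_one[OF hom] by simp
    have zero: "\<zero>\<^bsub>residue_field q\<^esub> = ?\<pi> 0"
      by (simp add: residue_field_def FactRing_def cos) (auto simp: mem)
    show "?\<pi> a = \<zero>\<^bsub>residue_field q\<^esub> \<longleftrightarrow> q dvd a" for a
    proof
      assume "?\<pi> a = \<zero>\<^bsub>residue_field q\<^esub>"
      then have eq: "{t. q dvd t - a} = {t. q dvd t - 0}" unfolding zero cos .
      have "a \<in> {t. q dvd t - a}" by simp
      then show "q dvd a" unfolding eq by simp
    next
      assume a: "q dvd a"
      have "q dvd t - a \<longleftrightarrow> q dvd t" for t using a by (metis dvd_diff_right_iff dvd_diff_left_iff)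
      then show "?\<pi> a = \<zero>\<^bsub>residue_field q\<^esub>" unfolding zero cos by simp
    qed
    show "P.subspace A" "P.subspace D" "D \<subseteq> A" by fact+
    fix w c assume w: "w \<in> A"
    show "?\<pi> c \<odot>\<^bsub>residue_space (quotient_module act A D)\<^esub> {w + b | b. b \<in> D} = {act c w + b | b. b \<in> D}"
      unfolding residue_space_def quotient_module_def module.simps
    proof (rule quotient_module_smult[OF A D w _ _ _ DA])
      show "c \<in> ?\<pi> c" by (simp add: cos)
      fix r x assume r: "r \<in> ?\<pi> c"
      show "act r x \<in> D" if "x \<in> D" using that P.subspace_scale[OF D] by blast
      assume x: "x \<in> A"
      obtain d where "r - c = d * q" using r by (auto simp: cos dvd_def mult.commute)
      then have "act r x - act c x = act d (act q x)"
        by (simp add: P.scale_left_diff_distrib[symmetric])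
      also have "\<dots> \<in> D" by (rule P.subspace_scale[OF D qA[OF x]])
      finally show "act r x - act c x \<in> D" .
    qed
  qed (simp_all add: residue_space_def quotient_module_def)
qed

text \<open>\<open>poly_shift 1 q\<close> is the quotient of \<open>q\<close> by x, so this is the
  division of \<open>q\<close> by x with remainder q(0).\<close>

lemma act_eval_0: "act q v = scale (poly q 0) v + act [:0, 1:] (act (poly_shift 1 q) v)"
proof -
  obtain a r where q: "q = pCons a r" by (cases q)
  then have "poly_shift 1 q = r" by (simp add: poly_eq_iff coeff_poly_shift)
  then show ?thesis by (simp add: q act_pCons T.zero)
qed

text \<open>As x maps \<open>A\<close> into \<open>D\<close>, a polynomial acts on A / D through its
  constant term alone.\<close>

lemma coset_space_eval_0:
  assumes A: "P.subspace A" and D: "P.subspace D" and DA: "D \<subseteq> A"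
    and xA: "\<And>v. v \<in> A \<Longrightarrow> act [:0, 1:] v \<in> D"
  shows "coset_space act [:0, 1:] A D class_ring (\<lambda>q. poly q 0) (quotient_module scale A D)"
proof (intro coset_space.intro[OF P.module_axioms] coset_space_axioms.intro)
  show "field (class_ring :: 'k ring)" by (rule class_field)
  show "range (\<lambda>q. poly q 0) = carrier (class_ring :: 'k ring)"
    by (auto intro!: range_eqI[of _ _ "[:_:]"])
  show "(poly a 0 = \<zero>\<^bsub>class_ring\<^esub>) = ([:0, 1:] dvd a)" for a :: "'k poly"
    using poly_eq_0_iff_dvd[of a 0] by simp
  show "P.subspace A" "P.subspace D" "D \<subseteq> A" by fact+
  fix w c assume w: "w \<in> A"
  have "(\<Union>r\<in>{c}. {scale (poly r 0) x + b | x b. x \<in> {w + b | b. b \<in> D} \<and> b \<in> D}) = {act c w + b | b. b \<in> D}"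
  proof (rule quotient_module_smult[OF A D w _ _ _ DA])
    fix r x assume "r \<in> {c}"
    show "scale (poly r 0) x \<in> D" if "x \<in> D"
      using P.subspace_scale[OF D that, of "[:poly r 0:]"] by (simp add: act_const)
    assume "x \<in> A"
    then have "act [:0, 1:] (act (poly_shift 1 c) x) \<in> D"
      using xA P.subspace_scale[OF A] by blast
    then have "- act [:0, 1:] (act (poly_shift 1 c) x) \<in> D" by (rule P.subspace_neg[OF D])
    moreover have "scale (poly r 0) x - act c x = - act [:0, 1:] (act (poly_shift 1 c) x)"
      using \<open>r \<in> {c}\<close> act_eval_0[of c x] by (simp only: singleton_iff) simp
    ultimately show "scale (poly r 0) x - act c x \<in> D" by simp
  qed simp
  then show "poly c 0 \<odot>\<^bsub>quotient_module scale A D\<^esub> {w + b | b. b \<in> D} = {act c w + b | b. b \<in> D}"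
    by (simp add: quotient_module_def)
qed (simp_all add: quotient_module_def)

section \<open>Primary components of torsion vectors\<close>

lemma comaximal_kernel_zero:
  assumes "comaximal a b" "act a v = 0" "act b v = 0"
  shows "v = 0"
proof -
  obtain x y where "x * a + y * b = 1" using assms by (auto simp: comaximal_def)
  then have "v = act (x * a + y * b) v" by simp
  also have "\<dots> = act x (act a v) + act y (act b v)" by (simp only: act_add_left act_mult)
  finally show ?thesis using assms by simp
qed

text \<open>The vector q^N v is killed by \<open>c\<close> and by q^s, which are comaximal, so it is
  zero.\<close>

lemma pker_stable:
  assumes q: "irreducible q" "\<not> q dvd c" and z: "act (q ^ N * c) v = 0" and v: "v \<in> P.pker q s"
  shows "v \<in> P.pker q N"
proof -
  have "comaximal (q ^ s) c" using irreducible_comaximal[OF q] by (rule comaximal_power_left)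
  moreover have "act (q ^ s) (act (q ^ N) v) = 0"
    using v P.scale_left_commute by (simp add: P.pker_def del: P.scale_scale)
  moreover have "act c (act (q ^ N) v) = 0" using z by (simp add: mult.commute)
  ultimately have "act (q ^ N) v = 0" by (rule comaximal_kernel_zero)
  then show ?thesis by (simp add: P.pker_def)
qed

text \<open>Write m = q^N c with \<open>q\<close> not dividing \<open>c\<close>, and 1 = x q^N + y
  c. Then x q^N v is killed by \<open>c\<close>, which has smaller degree than \<open>m\<close>, and
  y c v is killed by q^N.\<close>

lemma torsion_in_subspace:
  assumes S: "P.subspace S"
    and sub: "\<And>q s. irreducible q \<Longrightarrow> lead_coeff q = 1 \<Longrightarrow> P.pker q s \<subseteq> S"
    and m: "m \<noteq> 0" "act m v = 0"
  shows "v \<in> S"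
  using m
proof (induction "degree m" arbitrary: m v rule: less_induct)
  case less
  show ?case
  proof (cases "m dvd 1")
    case True
    then obtain e where "1 = e * m" by (auto simp: dvd_def mult.commute)
    then have "v = act e (act m v)" by (metis P.scale_one P.scale_scale)
    then show ?thesis using less.prems P.subspace_0[OF S] by simp
  next
    case False
    then obtain q where q: "irreducible q" "lead_coeff q = 1" "q dvd m"
      using irreducible_factor_exists less.prems by blast
    obtain N c where c: "m = q ^ N * c" "\<not> q dvd c"
      using poly_power_decomposition[OF less.prems(1) irreducible_degree_pos[OF q(1)]] by blast
    have "N \<noteq> 0" using c q(3) by (intro notI) simp
    have nz: "q \<noteq> 0" "c \<noteq> 0" using c less.prems q(1) by auto
    have "degree c < degree m"
      unfolding c(1) using nz \<open>N \<noteq> 0\<close> irreducible_degree_pos[OF q(1)]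
      by (simp add: degree_mult_eq degree_power_eq)
    obtain x y where xy: "x * q ^ N + y * c = 1"
      using comaximal_power_left[OF irreducible_comaximal[OF q(1) c(2)], of N] by (auto simp: comaximal_def)
    have "act c (act (x * q ^ N) v) = act x (act m v)" by (simp add: c(1) mult_ac)
    then have "act (x * q ^ N) v \<in> S"
      using less.hyps[OF \<open>degree c < degree m\<close> nz(2)] less.prems by simp
    moreover have "act (q ^ N) (act (y * c) v) = act y (act m v)"
      by (simp add: c(1) mult_ac)
    then have "act (y * c) v \<in> P.pker q N" using less.prems by (simp add: P.pker_def)
    then have "act (y * c) v \<in> S" using sub[OF q(1,2)] by blast
    ultimately have "act (x * q ^ N) v + act (y * c) v \<in> S" by (rule P.subspace_add[OF S])
    then show ?thesis by (simp add: xy flip: act_add_left)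
  qed
qed

end

section \<open>Lifted bases over all primes and orders\<close>

definition family_index :: "('k::field poly \<Rightarrow> nat \<Rightarrow> 'i set) \<Rightarrow> ('k poly \<times> nat \<times> 'i) set" where
  "family_index I = {(q, s, i). irreducible q \<and> lead_coeff q = 1 \<and> 1 \<le> s \<and> i \<in> I q s}"

definition quot_family ::
  "('k::field \<Rightarrow> 'v::ab_group_add \<Rightarrow> 'v) \<Rightarrow> ('v \<Rightarrow> 'v) \<Rightarrow> ('k poly \<Rightarrow> nat \<Rightarrow> 'i set) \<Rightarrow> ('k poly \<Rightarrow> nat \<Rightarrow> 'i \<Rightarrow> 'v) \<Rightarrow> bool"
  where
  "quot_family scale T I v \<longleftrightarrow>
     (\<forall>q s. irreducible q \<longrightarrow> lead_coeff q = 1 \<longrightarrow> 1 \<le> s \<longrightarrow>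
        quot_basis (\<lambda>r. poly_endo scale r T) q
          (ring_action.pker (\<lambda>r. poly_endo scale r T) q s)
          (ring_action.psub (\<lambda>r. poly_endo scale r T) q s) (I q s) (v q s))"

context poly_action
begin

text \<open>To isolate a prime \<open>q\<close>, the relation is multiplied by the product
  \<open>c\<close> of the annihilators of all terms at other primes. Those terms vanish,
  \<open>primary_independent\<close> makes q^s divide \<open>c\<close> times the coefficient, and
  \<open>c\<close> cancels because it is comaximal with q^s.\<close>

lemma family_independent:
  assumes fam: "quot_family scale T I v"
  shows "P.cyclic_independent (family_index I) (\<lambda>(q, s, i). v q s i) (\<lambda>(q, s, i). q ^ s)"
  unfolding P.cyclic_independent_def
proof (intro conjI ballI allI impI)
  have qb: "quot_basis act q (P.pker q s) (P.psub q s) (I q s) (v q s)"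
    if "irreducible q" "lead_coeff q = 1" "1 \<le> s" for q s
    using fam that by (simp add: quot_family_def)
  let ?v = "\<lambda>(q, s, i). v q s i" and ?a = "\<lambda>(q, s, i). q ^ s"
  have ker: "?v f \<in> P.pker (fst f) (fst (snd f))" if "f \<in> family_index I" for f
  proof -
    obtain q s i where "f = (q, s, i)" by (cases f) auto
    with that qb[of q s] show ?thesis by (auto simp: family_index_def quot_basis_mem)
  qed
  show zero: "act (?a f) (?v f) = 0" if "f \<in> family_index I" for f
    using ker[OF that] by (auto simp: P.pker_def split: prod.splits)
  fix F r f assume F: "finite F" "F \<subseteq> family_index I" "(\<Sum>f\<in>F. act (r f) (?v f)) = 0" and f: "f \<in> F"
  obtain q s i where f_eq: "f = (q, s, i)" by (cases f) auto
  have q: "irreducible q" "lead_coeff q = 1" using f F(2) by (auto simp: f_eq family_index_def)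
  define J where "J = {f\<in>F. fst f = q}"
  define c where "c = (\<Prod>f\<in>F - J. ?a f)"
  have com: "comaximal q (?a g)" if "g \<in> F - J" for g
  proof -
    obtain q' s' i' where g: "g = (q', s', i')" by (cases g) auto
    have "irreducible q'" "lead_coeff q' = 1" "q \<noteq> q'"
      using that F(2) by (auto simp: g family_index_def J_def)
    then show ?thesis using monic_irreducible_comaximal q by (auto simp: g intro: comaximal_power_right)
  qed
  then have com_c: "comaximal (q ^ s) c"
    unfolding c_def by (intro comaximal_power_left comaximal_prod_right)
  have kill: "act (c * r g) (?v g) = 0" if g: "g \<in> F - J" for g
  proof -
    have "?a g dvd c" unfolding c_def using g F(1) by (intro dvd_prodI) auto
    then obtain d where "c = d * ?a g" by (auto simp: dvd_def mult.commute)
    then have "c * r g = (d * r g) * ?a g" by (simp add: mult_ac)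
    then have "act (c * r g) (?v g) = act (d * r g) (act (?a g) (?v g))" by (simp only: act_mult)
    also have "act (?a g) (?v g) = 0" using g F(2) by (intro zero) auto
    finally show ?thesis by simp
  qed
  have "(\<Sum>g\<in>J. act (c * r g) (?v g)) = (\<Sum>g\<in>F. act (c * r g) (?v g))"
    by (rule sum.mono_neutral_left) (use F(1) kill in \<open>auto simp: J_def\<close>)
  also have "\<dots> = act c (\<Sum>f\<in>F. act (r f) (?v f))"
    unfolding P.scale_sum_right by (simp only: act_mult)
  finally have sum0: "(\<Sum>g\<in>J. act (c * r g) (?v g)) = 0" by (simp add: F(3))
  have "q ^ fst (snd f) dvd c * r f"
  proof (rule P.primary_independent[where J = J and ord = "\<lambda>f. fst (snd f)" and u = ?v and r = "\<lambda>g. c * r g"])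
    show "finite J" using F(1) by (simp add: J_def)
    show "?v g \<in> P.pker q (fst (snd g))" if "g \<in> J" for g
      using ker[of g] that F(2) by (auto simp: J_def)
    show "f \<in> J" using f by (simp add: J_def f_eq)
    fix t b g
    assume t: "1 \<le> t" and b: "(\<Sum>j\<in>{j\<in>J. fst (snd j) = t}. act (b j) (?v j)) \<in> P.psub q t"
      and g: "g \<in> J" "fst (snd g) = t"
    define G where "G = (\<lambda>j. snd (snd j)) ` {j\<in>J. fst (snd j) = t}"
    have "{j\<in>J. fst (snd j) = t} = (\<lambda>i. (q, t, i)) ` G"
      by (force simp: G_def J_def)
    then have "(\<Sum>j\<in>{j\<in>J. fst (snd j) = t}. act (b j) (?v j)) = (\<Sum>i\<in>G. act (b (q, t, i)) (v q t i))"
      by (simp add: sum.reindex inj_on_def)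
    then have "(\<Sum>i\<in>G. act (b (q, t, i)) (v q t i)) \<in> P.psub q t" using b by simp
    moreover have "finite G" "G \<subseteq> I q t"
      using F(1,2) by (auto simp: G_def J_def family_index_def)
    ultimately have "q dvd b (q, t, i)" if "i \<in> G" for i
      using quot_basis_dvd[OF qb[OF q t], where r = "\<lambda>i. b (q, t, i)"] that by blast
    moreover have "g = (q, t, snd (snd g))" "snd (snd g) \<in> G"
      using g by (auto simp: J_def G_def prod_eq_iff)
    ultimately show "q dvd b g" by metis
  qed (rule sum0)
  then have "q ^ s dvd c * r f" unfolding f_eq fst_conv snd_conv .
  then have "q ^ s dvd r f" by (rule comaximal_dvd_mult[OF com_c])
  then show "?a f dvd r f" unfolding f_eq prod.case .
qed

lemma family_spans:
  assumes fam: "quot_family scale T I v" and m: "m \<noteq> 0" "\<And>v. act m v = 0"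
  shows "P.span ((\<lambda>(q, s, i). v q s i) ` family_index I) = UNIV"
proof -
  let ?v = "\<lambda>(q, s, i). v q s i"
  let ?S = "P.span (?v ` family_index I)"
  have "x \<in> ?S" for x
  proof (rule torsion_in_subspace[OF _ _ m])
    show "P.subspace ?S" by simp
    fix q :: "'k poly" and s assume q: "irreducible q" "lead_coeff q = 1"
    \<comment> \<open>The exponent \<open>N\<close> of \<open>q\<close> in \<open>m\<close> bounds
      the kernels of all powers of \<open>q\<close>.\<close>
    obtain N c where c: "m = q ^ N * c" "\<not> q dvd c"
      using poly_power_decomposition[OF m(1) irreducible_degree_pos[OF q(1)]] by metis
    have z: "act (q ^ N * c) x = 0" for x using m(2) c(1) by simp
    show "P.pker q s \<subseteq> ?S"
    proof (rule P.primary_subset)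
      show "P.subspace ?S" by simp
      show "P.pker q s \<subseteq> P.pker q N" for s
        using pker_stable[OF q(1) c(2) z] by (intro subsetI)
      fix t a assume t: "1 \<le> t" and a: "a \<in> P.pker q t"
      have "quot_basis act q (P.pker q t) (P.psub q t) (I q t) (v q t)"
        using fam q t by (simp add: quot_family_def)
      then obtain F r where F: "F \<subseteq> I q t" "a - (\<Sum>i\<in>F. act (r i) (v q t i)) \<in> P.psub q t"
        using a by (rule quot_basis_spanE)
      have "(\<Sum>i\<in>F. act (r i) (v q t i)) \<in> ?S"
      proof (intro P.span_sum P.span_scale P.span_base)
        fix i assume "i \<in> F"
        then have "(q, t, i) \<in> family_index I" using F q t by (auto simp: family_index_def)
        then show "v q t i \<in> ?v ` family_index I" by (rule image_eqI[rotated]) simp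
      qed
      then show "\<exists>y\<in>?S. a - y \<in> P.psub q t" using F(2) by blast
    qed
  qed
  then show ?thesis by auto
qed

end

text \<open>Surjectivity is kept conditional so that one construction serves both cases of the
  theorem: in finite dimension \<open>g\<close> is only known to be injective, in infinite dimension
  it is also onto. The polynomial \<open>m'\<close> ensures that the family of \<open>T'\<close>
  generates V.\<close>

lemma linear_of_families:
  fixes scale :: "'k::field \<Rightarrow> 'v::ab_group_add \<Rightarrow> 'v" and g :: "'k poly \<Rightarrow> nat \<Rightarrow> 'i \<Rightarrow> 'j"
  assumes "poly_action scale T" "poly_action scale T'"
    and fam: "quot_family scale T I v" and fam': "quot_family scale T' I' v'"
    and m: "m \<noteq> 0" "\<And>v. poly_endo scale m T v = 0"
    and g: "\<And>q s. irreducible q \<Longrightarrow> lead_coeff q = 1 \<Longrightarrow> 1 \<le> s \<Longrightarrow> inj_on (g q s) (I q s) \<and> g q s ` I q s \<subseteq> I' q s"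
  shows "\<exists>\<tau>. Vector_Spaces.linear scale scale \<tau> \<and> inj \<tau> \<and> (\<forall>x. \<tau> (T x) = T' (\<tau> x)) \<and>
    ((\<forall>q s. irreducible q \<longrightarrow> lead_coeff q = 1 \<longrightarrow> 1 \<le> s \<longrightarrow> g q s ` I q s = I' q s) \<longrightarrow>
     (\<exists>m'. m' \<noteq> 0 \<and> (\<forall>v. poly_endo scale m' T' v = 0)) \<longrightarrow> surj \<tau>)"
proof -
  interpret A: poly_action scale T by fact
  interpret B: poly_action scale T' by fact
  \<comment> \<open>The map \<open>G\<close> keeps the prime and the order, so corresponding
    generators have the same annihilator.\<close>
  define G where "G = (\<lambda>(q, s, i). (q, s, g q s i))"
  let ?I = "family_index I" and ?I' = "family_index I'"
  let ?v = "\<lambda>(q, s, i). v q s i" and ?v' = "\<lambda>(q, s, i). v' q s i"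
  let ?a = "\<lambda>(q, s, i). q ^ s :: 'k poly"
  have inj: "inj_on G ?I"
    using g by (auto simp: inj_on_def G_def family_index_def)
  have sub: "G ` ?I \<subseteq> ?I'" using g by (auto simp: G_def family_index_def)
  have "B.P.cyclic_independent ?I (\<lambda>f. ?v' (G f)) (\<lambda>f. ?a (G f))"
    by (rule B.P.cyclic_independent_reindex[OF B.family_independent[OF fam'] inj sub])
  also have "(\<lambda>f. (case G f of (q, s, i) \<Rightarrow> q ^ s)) = (\<lambda>(q, s, i). q ^ s)"
    by (auto simp: G_def)
  finally have ind': "B.P.cyclic_independent ?I (\<lambda>f. ?v' (G f)) (\<lambda>(q, s, i). q ^ s)" .
  obtain \<tau> where \<tau>: "\<And>x y. \<tau> (x + y) = \<tau> x + \<tau> y" "\<And>r x. \<tau> (A.act r x) = B.act r (\<tau> x)"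
      "inj \<tau>" "range \<tau> = B.P.span ((\<lambda>f. ?v' (G f)) ` ?I)"
    using cyclic_family_hom[OF A.P.ring_action_axioms B.P.ring_action_axioms A.family_independent[OF fam] ind'
        A.family_spans[OF fam m]] by blast
  show ?thesis
  proof (intro exI[of _ \<tau>] conjI impI allI)
    \<comment> \<open>Constant polynomials give linearity over k, and x gives the commutation with
      the endomorphisms.\<close>
    have "\<tau> (scale c x) = scale c (\<tau> x)" for c x
      using \<tau>(2)[of "[:c:]" x] by (simp add: A.act_const B.act_const)
    then show "Vector_Spaces.linear scale scale \<tau>"
      by unfold_locales (simp_all add: \<tau>(1))
    show "\<tau> (T x) = T' (\<tau> x)" for x
      using \<tau>(2)[of "[:0, 1:]" x] by (simp add: A.act_x B.act_x)
    assume eq: "\<forall>q s. irreducible q \<longrightarrow> lead_coeff q = 1 \<longrightarrow> 1 \<le> s \<longrightarrow> g q s ` I q s = I' q s"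
      and "\<exists>m'. m' \<noteq> 0 \<and> (\<forall>v. poly_endo scale m' T' v = 0)"
    then obtain m' where m': "m' \<noteq> 0" "\<And>v. B.act m' v = 0" by blast
    have "G ` ?I = ?I'"
    proof
      show "?I' \<subseteq> G ` ?I"
      proof
        fix f assume f: "f \<in> ?I'"
        obtain q s j where f_eq: "f = (q, s, j)" by (cases f) auto
        then have "irreducible q" "lead_coeff q = 1" "1 \<le> s" "j \<in> I' q s"
          using f by (auto simp: family_index_def)
        moreover from this obtain i where "i \<in> I q s" "j = g q s i" using eq by blast
        ultimately have "(q, s, i) \<in> ?I" "f = G (q, s, i)"
          by (auto simp: family_index_def G_def f_eq)
        then show "f \<in> G ` ?I" by blast
      qed
    qed (rule sub)
    then have "(\<lambda>f. ?v' (G f)) ` ?I = ?v' ` ?I'" by (metis image_image)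
    then show "surj \<tau>" using B.family_spans[OF fam' m'] \<tau>(4) by simp
  qed (rule \<tau>(3))
qed

subsection \<open>Invariants of the AST-decomposition\<close>

lemma finite_dim_inj_imp_surj:
  assumes "vector_space scale" and fd: "finite_dim scale (UNIV :: 'v::ab_group_add set)"
    and lin: "Vector_Spaces.linear scale scale (f :: 'v \<Rightarrow> 'v)" and "inj f"
  shows "surj f"
proof -
  interpret V: vector_space scale by fact
  obtain B where B: "finite B" "V.span B = UNIV" using fd by (auto simp: finite_dim_def)
  obtain B' where B': "B' \<subseteq> B" "V.independent B'" "B \<subseteq> V.span B'"
    by (rule V.maximal_independent_subset)
  have "V.span B \<subseteq> V.span B'" using V.span_mono[OF B'(3)] V.span_span by metis
  then interpret F: finite_dimensional_vector_space scale B'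
    using B B' finite_subset by unfold_locales auto
  interpret P: finite_dimensional_vector_space_pair scale B' scale B' ..
  show ?thesis using P.linear_injective_imp_surjective[OF lin \<open>inj f\<close>] by simp
qed

context poly_action
begin

lemma act_x_eq: "act [:0, 1:] = T"
  by (auto simp: act_x)

lemma act_invariant:
  assumes "V.subspace S" "T ` S \<subseteq> S" "v \<in> S"
  shows "act q v \<in> S"
  using assms
  by (induction q) (auto simp: act_pCons V.subspace_0 intro!: V.subspace_add V.subspace_scale)

lemma ker_sum_eq_psub:
  assumes "\<And>i. ker_pow S (act q) i = P.pker q i"
  shows "ker_sum S (act q) s = P.psub q s"
  unfolding ker_sum_def P.psub_def assms by auto

lemma subspace_kernel: "V.subspace {v. act q v = 0}"
  by (rule V.subspaceI) (auto simp: act_add_right act_scale_right)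

text \<open>The iterates T^i b with i \<le> \<open>card B\<close> are one more in number than the
  spanning vectors, hence dependent. Since dependence concerns sets of vectors, coinciding iterates
  are a case of their own, where x^i - x^j kills \<open>b\<close>.\<close>

lemma vector_annihilated:
  assumes B: "finite B" and b: "\<And>i. (T ^^ i) b \<in> V.span B"
  shows "\<exists>q. q \<noteq> 0 \<and> act q b = 0"
proof (cases "inj_on (\<lambda>i. (T ^^ i) b) {..card B}")
  case False
  then obtain i j where ij: "i \<noteq> j" "(T ^^ i) b = (T ^^ j) b" by (auto simp: inj_on_def)
  let ?q = "[:0, 1:] ^ i - [:0, 1:] ^ j :: 'k poly"
  have "act ?q b = 0" using ij(2) by (simp add: P.scale_left_diff_distrib T_pow)
  moreover have "degree ([:0, 1:] ^ i :: 'k poly) \<noteq> degree ([:0, 1:] ^ j :: 'k poly)"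
    using ij(1) by (simp add: degree_power_eq)
  then have "?q \<noteq> 0" by auto
  ultimately show ?thesis by blast
next
  case True
  let ?X = "(\<lambda>i. (T ^^ i) b) ` {..card B}"
  have "card ?X = Suc (card B)" using card_image[OF True] by simp
  then have "V.dependent ?X"
    using V.independent_span_bound[OF B, of ?X] b by fastforce
  then obtain u where u: "(\<Sum>v\<in>?X. scale (u v) v) = 0" "\<exists>v\<in>?X. u v \<noteq> 0"
    using V.dependent_finite[of ?X] by auto
  define q where "q = (\<Sum>i\<le>card B. Polynomial.monom (u ((T ^^ i) b)) i)"
  have "act q b = (\<Sum>i\<le>card B. scale (u ((T ^^ i) b)) ((T ^^ i) b))"
    unfolding q_def P.scale_sum_left by (simp add: monom_altdef act_smult T_pow)
  also have "\<dots> = 0" using u(1) by (simp add: sum.reindex[OF True])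
  finally have "act q b = 0" .
  moreover obtain i where "i \<le> card B" "u ((T ^^ i) b) \<noteq> 0" using u(2) by auto
  then have "coeff q i \<noteq> 0" by (simp add: q_def coeff_sum)
  then have "q \<noteq> 0" by auto
  ultimately show ?thesis by blast
qed

lemma finite_dim_annihilated:
  assumes W: "finite_dim scale W" "T ` W \<subseteq> W"
  shows "\<exists>q. q \<noteq> 0 \<and> (\<forall>w\<in>W. act q w = 0)"
proof -
  obtain B where B: "finite B" "V.span B = W" using W(1) by (auto simp: finite_dim_def)
  have "(T ^^ i) b \<in> V.span B" if "b \<in> B" for b i
    by (induction i) (use that V.span_base W(2) B(2) in auto)
  then have "\<forall>b\<in>B. \<exists>q. q \<noteq> 0 \<and> act q b = 0" using vector_annihilated[OF B(1)] by blast
  then obtain f where f: "\<And>b. b \<in> B \<Longrightarrow> f b \<noteq> 0 \<and> act (f b) b = 0" by metis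
  define q where "q = (\<Prod>b\<in>B. f b)"
  have "act q b = 0" if "b \<in> B" for b
  proof -
    have "q = (\<Prod>b\<in>B - {b}. f b) * f b"
      using that B(1) by (simp add: q_def prod.remove mult.commute)
    then have "act q b = act (\<Prod>b\<in>B - {b}. f b) (act (f b) b)" by (simp only: act_mult)
    then show ?thesis using f[OF that] by simp
  qed
  then have "W \<subseteq> {v. act q v = 0}"
    unfolding B(2)[symmetric] by (intro V.span_minimal subspace_kernel) auto
  moreover have "q \<noteq> 0" using f B(1) by (simp add: q_def)
  ultimately show ?thesis by blast
qed

end

locale ast = poly_action scale T
  for scale :: "'k::field \<Rightarrow> 'v::ab_group_add \<Rightarrow> 'v" and T :: "'v \<Rightarrow> 'v" +
  fixes U W :: "'v set"
  assumes ast: "AST_decomposition scale T U W"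
begin

lemma subspace_U: "V.subspace U" and subspace_W: "V.subspace W" and U_Int_W: "U \<inter> W = {0}"
  and T_U: "T ` U \<subseteq> U" and T_W: "T ` W \<subseteq> W" and finite_dim_W: "finite_dim scale W"
  using ast by (simp_all add: AST_decomposition_def)

lemma UW_E:
  obtains u w where "v = u + w" "u \<in> U" "w \<in> W"
proof -
  have "v \<in> {u + w | u w. u \<in> U \<and> w \<in> W}" using ast by (simp add: AST_decomposition_def)
  then show ?thesis using that by blast
qed

lemma nilpotent_U: "\<exists>n. \<forall>u\<in>U. act ([:0, 1:] ^ n) u = 0"
  using ast by (simp add: AST_decomposition_def T_pow)

lemma T_pow_W_zero: "w \<in> W \<Longrightarrow> act ([:0, 1:] ^ n) w = 0 \<Longrightarrow> w = 0"
proof (induction n arbitrary: w)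
  case (Suc n)
  have inj: "inj_on T W" using ast by (simp add: AST_decomposition_def bij_betw_def)
  have "act ([:0, 1:] ^ n) (T w) = act ([:0, 1:] ^ Suc n) w" by (simp only: power_Suc act_mult act_x act_T_right)
  then have "act ([:0, 1:] ^ n) (T w) = 0" using Suc.prems(2) by simp
  moreover have "T w \<in> W" using Suc.prems(1) T_W by blast
  ultimately have "T w = T 0" using Suc.IH T.zero by simp
  then show ?case using inj_onD[OF inj _ Suc.prems(1) V.subspace_0[OF subspace_W]] by simp
qed simp

lemma sum_zero:
  assumes uw: "u \<in> U" "w \<in> W" "u + w = 0"
  shows "u = 0 \<and> w = 0"
proof -
  have "u = - w" using uw(3) by (simp add: add_eq_0_iff2)
  then have "u \<in> U \<inter> W" using uw V.subspace_neg[OF subspace_W] by simp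
  then have "u = 0" unfolding U_Int_W by simp
  then show ?thesis using uw(3) by simp
qed

lemma act_split:
  assumes "u \<in> U" "w \<in> W" "act q (u + w) = 0"
  shows "act q u = 0" "act q w = 0"
  using sum_zero[OF act_invariant[OF subspace_U T_U assms(1)] act_invariant[OF subspace_W T_W assms(2)], of q q]
    assms(3) by (simp_all add: act_add_right)

text \<open>As \<open>T\<close> is injective on \<open>W\<close>, the \<open>W\<close>-component of
  a vector killed by a power of x is zero.\<close>

lemma ker_pow_U: "ker_pow U T i = P.pker [:0, 1:] i"
proof (intro equalityI subsetI)
  fix v assume v: "v \<in> P.pker [:0, 1:] i"
  obtain u w where uw: "v = u + w" "u \<in> U" "w \<in> W" by (rule UW_E)
  then have "act ([:0, 1:] ^ i) w = 0" using v act_split(2) by (simp add: P.pker_def)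
  then have "w = 0" by (rule T_pow_W_zero[OF uw(3)])
  then show "v \<in> ker_pow U T i" using uw v by (simp add: ker_pow_def T_pow P.pker_def)
qed (simp add: ker_pow_def T_pow P.pker_def)

text \<open>The \<open>U\<close>-component is killed by a power of x and by q^s, which are
  comaximal, so it is zero.\<close>

lemma ker_pow_W:
  assumes "\<not> [:0, 1:] dvd q"
  shows "ker_pow W (act q) s = P.pker q s"
proof (intro equalityI subsetI)
  fix v assume v: "v \<in> P.pker q s"
  obtain u w where uw: "v = u + w" "u \<in> U" "w \<in> W" by (rule UW_E)
  obtain n where n: "\<forall>u\<in>U. act ([:0, 1:] ^ n) u = 0" using nilpotent_U by blast
  have "comaximal ([:0, 1:] ^ n) (q ^ s)"
    using irreducible_comaximal[OF irreducible_x assms]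
    by (intro comaximal_power_left comaximal_power_right)
  moreover have "act (q ^ s) u = 0" using v uw act_split(1) by (simp add: P.pker_def)
  ultimately have "u = 0" using n uw(2) comaximal_kernel_zero by blast
  then show "v \<in> ker_pow W (act q) s" using uw v by (simp add: ker_pow_def act_pow P.pker_def)
qed (simp add: ker_pow_def act_pow P.pker_def)

text \<open>An irreducible multiple of x is an associate of x and therefore acts injectively on
  \<open>W\<close>. In infinite dimension the theorem compares \<nu> for every irreducible
  \<open>q\<close>, these included.\<close>

lemma ker_pow_W_trivial:
  assumes "irreducible q" "[:0, 1:] dvd q"
  shows "ker_pow W (act q) s = {0}"
proof (intro equalityI subsetI)
  fix w assume "w \<in> ker_pow W (act q) s"
  then have w: "w \<in> W" "act (q ^ s) w = 0" by (simp_all add: ker_pow_def act_pow)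
  obtain c where c: "q = [:0, 1:] * c" using assms(2) by (auto simp: dvd_def)
  have "[:0, 1 :: 'k:] dvd 1 \<or> c dvd 1" by (rule irreducibleD[OF assms(1) c])
  moreover have "\<not> [:0, 1 :: 'k:] dvd 1"
    by (rule irreducible_not_unit[OF irreducible_x])
  ultimately obtain d where "1 = c * d" by (auto simp: dvd_def)
  then have x: "[:0, 1:] = q * d" unfolding c by (metis mult.assoc mult_1_right)
  have "act ([:0, 1:] ^ s) w = act (d ^ s) (act (q ^ s) w)"
    unfolding x by (simp add: power_mult_distrib mult.commute)
  then show "w \<in> {0}" using w T_pow_W_zero by simp
qed (simp add: ker_pow_def act_pow V.subspace_0[OF subspace_W])

lemma coset_space_mu:
  "coset_space act [:0, 1:] (P.pker [:0, 1:] i) (P.psub [:0, 1:] i) class_ring (\<lambda>q. poly q 0)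
     (quotient_module scale (P.pker [:0, 1:] i) (P.psub [:0, 1:] i))"
  by (intro coset_space_eval_0 P.subspace_pker P.subspace_psub P.psub_subset_pker P.scale_pker_in_psub)

lemma mu_eq:
  "mu scale U T i = dimension (class_ring :: 'k ring) (quotient_module scale (P.pker [:0, 1:] i) (P.psub [:0, 1:] i))"
proof -
  have "ker_pow U (act [:0, 1:]) i = P.pker [:0, 1:] i" for i by (simp only: act_x_eq ker_pow_U)
  then have "ker_sum U (act [:0, 1:]) i = P.psub [:0, 1:] i" by (rule ker_sum_eq_psub)
  then show ?thesis by (simp only: mu_def act_x_eq ker_pow_U)
qed

lemma mu_basis_exists:
  "\<exists>(I :: 'v set set) w. quot_basis act [:0, 1:] (P.pker [:0, 1:] i) (P.psub [:0, 1:] i) I w \<and> mu scale U T i = |I|"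
  unfolding mu_eq by (rule coset_space.quot_basis_of_dimension[OF coset_space_mu])

lemma mu_ordIso:
  "quot_basis act [:0, 1:] (P.pker [:0, 1:] i) (P.psub [:0, 1:] i) I w \<Longrightarrow> mu scale U T i =o |I|"
  unfolding mu_eq by (rule coset_space.dimension_ordIso_quot_basis[OF coset_space_mu])

lemma coset_space_nu:
  assumes "irreducible q"
  shows "coset_space act q (P.pker q s) (P.psub q s) (residue_field q)
    (\<lambda>r. PIdl\<^bsub>class_ring\<^esub> q +>\<^bsub>class_ring\<^esub> r) (residue_space (quotient_module act (P.pker q s) (P.psub q s)))"
  using assms
  by (intro coset_space_residue P.subspace_pker P.subspace_psub P.psub_subset_pker P.scale_pker_in_psub)

lemma nu_eq:
  assumes "\<not> [:0, 1:] dvd q"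
  shows "nu scale W q T s = dimension (residue_field q) (residue_space (quotient_module act (P.pker q s) (P.psub q s)))"
  using ker_sum_eq_psub[OF ker_pow_W[OF assms]] by (simp add: nu_def ker_pow_W[OF assms])

lemma nu_basis_exists:
  assumes "irreducible q" "\<not> [:0, 1:] dvd q"
  shows "\<exists>(I :: 'v set set) w. quot_basis act q (P.pker q s) (P.psub q s) I w \<and> nu scale W q T s = |I|"
  unfolding nu_eq[OF assms(2)] by (rule coset_space.quot_basis_of_dimension[OF coset_space_nu[OF assms(1)]])

lemma nu_ordIso:
  assumes "irreducible q" "\<not> [:0, 1:] dvd q" "quot_basis act q (P.pker q s) (P.psub q s) I w"
  shows "nu scale W q T s =o |I|"
  unfolding nu_eq[OF assms(2)] by (rule coset_space.dimension_ordIso_quot_basis[OF coset_space_nu[OF assms(1)] assms(3)])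

lemma nu_trivial:
  assumes "irreducible q" "[:0, 1:] dvd q"
  shows "nu scale W q T s =o |{} :: 'v set|"
proof -
  note ker = ker_pow_W_trivial[OF assms]
  have "ker_sum W (act q) s = {0}" by (simp add: ker_sum_def ker)
  then have "nu scale W q T s = dimension (residue_field q) (residue_space (quotient_module act {0} {0}))"
    by (simp add: nu_def ker)
  moreover have "coset_space act q {0} {0} (residue_field q)
      (\<lambda>r. PIdl\<^bsub>class_ring\<^esub> q +>\<^bsub>class_ring\<^esub> r) (residue_space (quotient_module act {0} {0}))"
    using assms(1) by (intro coset_space_residue) simp_all
  moreover have "quot_basis act q {0} {0} {} (\<lambda>v :: 'v. v)" by (simp add: quot_basis_def)
  ultimately show ?thesis using coset_space.dimension_ordIso_quot_basis by metis
qed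

lemma total_annihilator:
  assumes "\<forall>u\<in>U. act a u = 0" "\<forall>w\<in>W. act b w = 0"
  shows "act (a * b) v = 0"
proof -
  obtain u w where v: "v = u + w" "u \<in> U" "w \<in> W" by (rule UW_E)
  have "act b (act a u) = 0" "act a (act b w) = 0"
    by (simp_all only: bspec[OF assms(1) v(2)] bspec[OF assms(2) v(3)] P.scale_zero_right)
  then have "act (a * b) u = 0" "act (a * b) w = 0" by (simp_all add: mult.commute)
  then show ?thesis by (simp add: v(1) act_add_right)
qed

lemma annihilated: "\<exists>m. m \<noteq> 0 \<and> (\<forall>v. act m v = 0)"
proof -
  obtain n where n: "\<forall>u\<in>U. act ([:0, 1:] ^ n) u = 0" using nilpotent_U by blast
  obtain q where q: "q \<noteq> 0" "\<forall>w\<in>W. act q w = 0" using finite_dim_annihilated[OF finite_dim_W T_W] by blast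
  have "[:0, 1:] ^ n * q \<noteq> 0" using q(1) by simp
  then show ?thesis using total_annihilator[OF n q(2)] by blast
qed

definition invariant :: "'k poly \<Rightarrow> nat \<Rightarrow> 'v set rel" where
  "invariant q s = (if q = [:0, 1:] then mu scale U T s else nu scale W q T s)"

lemma monic_not_x_dvd:
  fixes q :: "'k poly"
  assumes "irreducible q" "lead_coeff q = 1" "q \<noteq> [:0, 1:]"
  shows "\<not> [:0, 1:] dvd q"
  using monic_irreducible_dvd_eq[OF irreducible_x assms(1)] assms by auto

lemma family_exists:
  "\<exists>I w. quot_family scale T I (w :: 'k poly \<Rightarrow> nat \<Rightarrow> 'v set \<Rightarrow> 'v) \<and>
    (\<forall>q s. irreducible q \<longrightarrow> lead_coeff q = 1 \<longrightarrow> invariant q s = |I q s| )"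
proof -
  have "\<exists>(I :: 'v set set) w. irreducible q \<longrightarrow> lead_coeff q = 1 \<longrightarrow>
      quot_basis act q (P.pker q s) (P.psub q s) I w \<and> invariant q s = |I|" for q s
    using mu_basis_exists nu_basis_exists[OF _ monic_not_x_dvd] unfolding invariant_def
    by (cases "q = [:0, 1:]") auto
  then obtain I :: "'k poly \<Rightarrow> nat \<Rightarrow> 'v set set" and w where
    "\<And>q s. irreducible q \<longrightarrow> lead_coeff q = 1 \<longrightarrow>
      quot_basis act q (P.pker q s) (P.psub q s) (I q s) (w q s) \<and> invariant q s = |I q s|"
    by metis
  then show ?thesis unfolding quot_family_def by (intro exI[of _ I] exI[of _ w]) auto
qed

end

section \<open>Similarity and equality of the invariants\<close>

lemma quot_basis_transport:
  assumes "poly_action scale T" "poly_action scale T'"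
    and lin: "Vector_Spaces.linear scale scale \<tau>" and bij: "bij \<tau>" and com: "\<And>x. \<tau> (T x) = T' (\<tau> x)"
    and qb: "quot_basis (\<lambda>r. poly_endo scale r T) q (ring_action.pker (\<lambda>r. poly_endo scale r T) q s)
      (ring_action.psub (\<lambda>r. poly_endo scale r T) q s) I w"
  shows "quot_basis (\<lambda>r. poly_endo scale r T') q (ring_action.pker (\<lambda>r. poly_endo scale r T') q s)
      (ring_action.psub (\<lambda>r. poly_endo scale r T') q s) I (\<lambda>i. \<tau> (w i))"
proof -
  interpret A: poly_action scale T by fact
  interpret B: poly_action scale T' by fact
  interpret t: Vector_Spaces.linear scale scale \<tau> by fact
  \<comment> \<open>Commuting with the endomorphisms makes \<tau> an isomorphism of k[x]-modules, so
    it preserves kernels and their sums. The index set stays the same, and with it the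
    cardinal.\<close>
  have act: "\<tau> (A.act r x) = B.act r (\<tau> x)" for r x
    by (induction r) (simp_all add: A.act_pCons B.act_pCons t.add t.scale t.zero com)
  have inj: "inj \<tau>" using bij by (rule bij_is_inj)
  have zero: "\<tau> x = 0 \<longleftrightarrow> x = 0" for x using inj t.zero by (metis injD)
  have pker: "\<tau> x \<in> B.P.pker q i \<longleftrightarrow> x \<in> A.P.pker q i" for x i
    by (simp add: A.P.pker_def B.P.pker_def zero flip: act)
  have psub: "\<tau> x \<in> B.P.psub q i \<longleftrightarrow> x \<in> A.P.psub q i" for x i
  proof
    assume "x \<in> A.P.psub q i"
    then obtain a b where "x = a + A.act q b" "a \<in> A.P.pker q (i - 1)" "b \<in> A.P.pker q (i + 1)"
      unfolding A.P.psub_def by blast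
    then show "\<tau> x \<in> B.P.psub q i"
      unfolding B.P.psub_def
      by (intro CollectI exI[of _ "\<tau> a"] exI[of _ "\<tau> b"]) (simp add: t.add act pker)
  next
    assume "\<tau> x \<in> B.P.psub q i"
    then obtain a b where ab: "\<tau> x = a + B.act q b" "a \<in> B.P.pker q (i - 1)" "b \<in> B.P.pker q (i + 1)"
      unfolding B.P.psub_def by blast
    obtain a' b' where a'b': "a = \<tau> a'" "b = \<tau> b'" using bij by (meson bij_pointE)
    then have "\<tau> x = \<tau> (a' + A.act q b')" using ab by (simp add: t.add act)
    then have "x = a' + A.act q b'" using inj by (simp add: injD)
    then show "x \<in> A.P.psub q i"
      unfolding A.P.psub_def using ab a'b' by (auto simp: pker)
  qed
  have sum: "(\<Sum>i\<in>F. B.act (r i) (\<tau> (w i))) = \<tau> (\<Sum>i\<in>F. A.act (r i) (w i))" for F r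
    by (simp add: t.sum act)
  show ?thesis
    unfolding quot_basis_def sum psub
  proof (intro conjI allI impI ballI)
    show "(\<lambda>i. \<tau> (w i)) ` I \<subseteq> B.P.pker q s" using quot_basis_mem[OF qb] by (auto simp: pker)
    show "q dvd r i" if "finite F" "F \<subseteq> I" "(\<Sum>i\<in>F. A.act (r i) (w i)) \<in> A.P.psub q s" "i \<in> F" for F r i
      using quot_basis_dvd[OF qb that] .
    fix a assume a: "a \<in> B.P.pker q s"
    obtain b where b: "a = \<tau> b" using bij by (meson bij_pointE)
    then have "b \<in> A.P.pker q s" using a by (simp add: pker)
    then obtain F r where "finite F" "F \<subseteq> I" "b - (\<Sum>i\<in>F. A.act (r i) (w i)) \<in> A.P.psub q s"
      by (rule quot_basis_spanE[OF qb])
    then show "\<exists>F r. finite F \<and> F \<subseteq> I \<and> a - \<tau> (\<Sum>i\<in>F. A.act (r i) (w i)) \<in> B.P.psub q s"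
      unfolding b t.diff[symmetric] psub by blast
  qed
qed

theorem theorem3p18:
  fixes scale :: "'k::field \<Rightarrow> 'v::ab_group_add \<Rightarrow> 'v"
    and \<phi> \<psi> :: "'v \<Rightarrow> 'v"
    and U W U' W' :: "'v set"
    and n r :: nat
    and p :: "nat \<Rightarrow> 'k poly"
    and e :: "nat \<Rightarrow> nat"
  assumes "vector_space scale"
    and "finite_potent scale \<phi>"
    and "finite_potent scale \<psi>"
    and "AST_decomposition scale \<phi> U W"
    and "AST_decomposition scale \<psi> U' W'"
    and "nilpotency_order U \<phi> n"
    and "\<And>j. j \<in> {1..r} \<Longrightarrow> Factorial_Ring.irreducible (p j) \<and> lead_coeff (p j) = 1 \<and> 1 \<le> e j"
    and "inj_on p {1..r}"
    and "annihilator_polynomial scale W \<phi> (\<Prod>j = 1..r. p j ^ e j)"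
  shows "(\<exists>\<tau>. Vector_Spaces.linear scale scale \<tau> \<and> bij \<tau> \<and> \<psi> = \<tau> \<circ> \<phi> \<circ> inv_into UNIV \<tau>) \<longleftrightarrow>
      (\<forall>i\<in>{1..n}. mu scale U \<phi> i =o mu scale U' \<psi> i) \<and>
      (\<forall>j\<in>{1..r}. \<forall>s\<in>{1..e j}. nu scale W (p j) \<phi> s =o nu scale W' (p j) \<psi> s) \<and>
      (\<not> finite_dim scale (UNIV :: 'v set) \<longrightarrow>
         (\<forall>i\<ge>1. mu scale U \<phi> i =o mu scale U' \<psi> i) \<and>
         (\<forall>q. Factorial_Ring.irreducible q \<longrightarrow> (\<forall>s\<ge>1. nu scale W q \<phi> s =o nu scale W' q \<psi> s)))"
    (is "?similar \<longleftrightarrow> ?mu \<and> ?nu \<and> (?infinite \<longrightarrow> ?all_mu \<and> ?all_nu)")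
proof
  interpret A: ast scale \<phi> U W
    using assms(1,2,4) by (intro ast.intro poly_action.intro ast_axioms.intro) (auto simp: finite_potent_def)
  interpret B: ast scale \<psi> U' W'
    using assms(1,3,5) by (intro ast.intro poly_action.intro ast_axioms.intro) (auto simp: finite_potent_def)
  {
    assume ?similar
    then obtain \<tau> where \<tau>: "Vector_Spaces.linear scale scale \<tau>" "bij \<tau>" "\<psi> = \<tau> \<circ> \<phi> \<circ> inv_into UNIV \<tau>"
      by blast
    have com: "\<tau> (\<phi> x) = \<psi> (\<tau> x)" for x using \<tau> by (simp add: bij_is_inj)
    note transport = quot_basis_transport[OF A.poly_action_axioms B.poly_action_axioms \<tau>(1,2) com]
    have mu: "mu scale U \<phi> i =o mu scale U' \<psi> i" for i
    proof -
      obtain I :: "'v set set" and w where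
        "quot_basis A.act [:0, 1:] (A.P.pker [:0, 1:] i) (A.P.psub [:0, 1:] i) I w" "mu scale U \<phi> i = |I|"
        using A.mu_basis_exists by blast
      then show ?thesis using ordIso_symmetric[OF B.mu_ordIso[OF transport]] by metis
    qed
    have nu: "nu scale W q \<phi> s =o nu scale W' q \<psi> s" if q: "irreducible q" for q s
    proof (cases "[:0, 1:] dvd q")
      case True
      show ?thesis
        using A.nu_trivial[OF q True] B.nu_trivial[OF q True] ordIso_symmetric ordIso_transitive by blast
    next
      case False
      obtain I :: "'v set set" and w where
        "quot_basis A.act q (A.P.pker q s) (A.P.psub q s) I w" "nu scale W q \<phi> s = |I|"
        using A.nu_basis_exists[OF q False] by blast
      then show ?thesis using ordIso_symmetric[OF B.nu_ordIso[OF q False transport]] by metis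
    qed
    show "?mu \<and> ?nu \<and> (?infinite \<longrightarrow> ?all_mu \<and> ?all_nu)"
      using mu nu assms(7) by blast
  next
    assume H: "?mu \<and> ?nu \<and> (?infinite \<longrightarrow> ?all_mu \<and> ?all_nu)"
    obtain I w where I: "quot_family scale \<phi> I (w :: 'k poly \<Rightarrow> nat \<Rightarrow> 'v set \<Rightarrow> 'v)"
        "\<And>q s. irreducible q \<Longrightarrow> lead_coeff q = 1 \<Longrightarrow> A.invariant q s = |I q s|"
      using A.family_exists by blast
    obtain I' w' where I': "quot_family scale \<psi> I' (w' :: 'k poly \<Rightarrow> nat \<Rightarrow> 'v set \<Rightarrow> 'v)"
        "\<And>q s. irreducible q \<Longrightarrow> lead_coeff q = 1 \<Longrightarrow> B.invariant q s = |I' q s|"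
      using B.family_exists by blast
    define M where "M = (\<Prod>j = 1..r. p j ^ e j)"
    have "\<forall>w\<in>W. A.act M w = 0"
      using assms(9) dvd_refl unfolding annihilator_polynomial_def M_def by blast
    then have M: "A.act M v = 0" if "v \<in> W" for v using that by blast
    \<comment> \<open>The kernels of powers of x lie in \<open>U\<close>, where the
      \<open>n\<close>-th power of \<phi> vanishes, so they stop growing at
      \<open>n\<close>.\<close>
    have U: "A.P.pker [:0, 1:] s \<subseteq> A.P.pker [:0, 1:] n" for s
    proof
      fix v assume "v \<in> A.P.pker [:0, 1:] s"
      then have "v \<in> U" unfolding A.ker_pow_U[symmetric] by (simp add: ker_pow_def)
      then show "v \<in> A.P.pker [:0, 1:] n"
        using assms(6) unfolding A.ker_pow_U[symmetric] by (simp add: ker_pow_def nilpotency_order_def)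
    qed
    \<comment> \<open>A nonempty family forces the kernels of \<open>q\<close> to grow at
      \<open>s\<close>, so \<open>s\<close> is at most any exponent from which they are stationary:
      \<open>n\<close> for q = x, \<open>e j\<close> for q = \<open>p j\<close>, and 0 for every
      other prime. Hence (i) and (ii) cover all nonzero invariants of \<phi>.\<close>
    have inv_eq: "A.invariant q s =o B.invariant q s"
      if q: "irreducible q" "lead_coeff q = 1" "1 \<le> s" and ne: "I q s \<noteq> {}" for q s
    proof -
      obtain i where i: "i \<in> I q s" using ne by blast
      have "quot_basis A.act q (A.P.pker q s) (A.P.psub q s) (I q s) (w q s)"
        using I(1) q by (simp add: quot_family_def)
      then have v: "w q s i \<in> A.P.pker q s - A.P.psub q s"
        using i q(1) A.module_act quot_basis_not_mem by (metis irreducible_not_unit)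
      then have big: "\<not> A.P.pker q s \<subseteq> A.P.pker q (s - 1)" using A.P.psub_eq_pker by blast
      have bound: "s \<le> N" if "A.P.pker q s \<subseteq> A.P.pker q N" for N
      proof (rule ccontr)
        assume "\<not> s \<le> N"
        then have "A.P.pker q N \<subseteq> A.P.pker q (s - 1)" by (intro A.P.pker_mono) simp
        then show False using that big by blast
      qed
      show ?thesis
      proof (cases "q = [:0, 1:]")
        case True
        then have "s \<le> n" using bound U by blast
        then show ?thesis using H q(3) True by (simp add: A.invariant_def B.invariant_def)
      next
        case False
        have W: "v \<in> W" if "v \<in> A.P.pker q s" for v
          using that A.ker_pow_W[OF A.monic_not_x_dvd[OF q(1,2) False]] by (auto simp: ker_pow_def)
        have stable: "s \<le> N" if "M = q ^ N * c" "\<not> q dvd c" for N c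
          using A.pker_stable[OF q(1) that(2)] M W that(1) by (intro bound) blast
        have prod: "\<not> q dvd (\<Prod>j\<in>J. p j ^ e j)" if J: "J \<subseteq> {1..r}" "q \<notin> p ` J" for J
        proof
          have "comaximal q (p j)" if "j \<in> J" for j
          proof (rule monic_irreducible_comaximal[OF q(1) _ q(2)])
            show "irreducible (p j)" "lead_coeff (p j) = 1" using assms(7)[of j] J(1) that by auto
            show "q \<noteq> p j" using J(2) that by auto
          qed
          then have "comaximal q (\<Prod>j\<in>J. p j ^ e j)"
            by (intro comaximal_prod_right comaximal_power_right)
          moreover assume "q dvd (\<Prod>j\<in>J. p j ^ e j)"
          ultimately have "q dvd 1" using comaximal_dvd_mult[of q _ 1] by simp
          then show False using q(1) irreducible_not_unit by blast
        qed
        show ?thesis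
        proof (cases "q \<in> p ` {1..r}")
          case True
          then obtain j where j: "j \<in> {1..r}" "q = p j" by blast
          have "M = q ^ e j * (\<Prod>j\<in>{1..r} - {j}. p j ^ e j)"
            unfolding M_def j(2) using j(1) by (intro prod.remove) auto
          moreover have "q \<notin> p ` ({1..r} - {j})"
          proof
            assume "q \<in> p ` ({1..r} - {j})"
            then obtain i where "i \<in> {1..r}" "i \<noteq> j" "p i = p j" unfolding j(2) by force
            then show False using inj_onD[OF assms(8)] j(1) by blast
          qed
          ultimately have "s \<le> e j" using stable[OF _ prod[of "{1..r} - {j}"]] by simp
          then have "nu scale W (p j) \<phi> s =o nu scale W' (p j) \<psi> s" using H q(3) j(1) by simp
          then show ?thesis using False by (simp add: A.invariant_def B.invariant_def j(2))
        next
          case F: False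
          \<comment> \<open>Here \<open>M\<close> itself takes the place of \<open>c\<close>, with
            exponent 0, which contradicts 1 \<le> \<open>s\<close>.\<close>
          then have "s \<le> 0" using stable[of 0 M] prod[of "{1..r}"] by (simp add: M_def)
          then show ?thesis using q(3) by simp
        qed
      qed
    qed
    have all_eq: "A.invariant q s =o B.invariant q s"
      if "?infinite" "irreducible q" "lead_coeff q = 1" "1 \<le> s" for q s
      using H that by (simp add: A.invariant_def B.invariant_def)
    \<comment> \<open>In finite dimension nothing is known about \<open>I' q s\<close> where
      \<open>I q s\<close> is empty. Any map serves there, and only the inclusion of the image is
      claimed.\<close>
    have "\<exists>g. irreducible q \<longrightarrow> lead_coeff q = 1 \<longrightarrow> 1 \<le> s \<longrightarrow>
        inj_on g (I q s) \<and> g ` I q s \<subseteq> I' q s \<and> (?infinite \<longrightarrow> g ` I q s = I' q s)" for q s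
    proof (cases "irreducible q \<and> lead_coeff q = 1 \<and> 1 \<le> s")
      case True
      then have q: "irreducible q" "lead_coeff q = 1" "1 \<le> s" by auto
      show ?thesis
      proof (cases "?infinite \<or> I q s \<noteq> {}")
        case True
        then have "A.invariant q s =o B.invariant q s"
          using inv_eq[OF q] all_eq[OF _ q] by blast
        then have "|I q s| =o |I' q s|" by (simp only: I(2)[OF q(1,2)] I'(2)[OF q(1,2)])
        then obtain g where "bij_betw g (I q s) (I' q s)" using card_of_ordIso by blast
        then show ?thesis by (auto simp: bij_betw_def)
      qed auto
    qed auto
    then obtain g where g: "\<And>q s. irreducible q \<longrightarrow> lead_coeff q = 1 \<longrightarrow> 1 \<le> s \<longrightarrow>
        inj_on (g q s) (I q s) \<and> g q s ` I q s \<subseteq> I' q s \<and> (?infinite \<longrightarrow> g q s ` I q s = I' q s)"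
      by metis
    obtain m where m: "m \<noteq> 0" "\<And>v. A.act m v = 0" using A.annihilated by blast
    have g': "inj_on (g q s) (I q s) \<and> g q s ` I q s \<subseteq> I' q s"
      if "irreducible q" "lead_coeff q = 1" "1 \<le> s" for q s
      using g that by blast
    have "\<exists>\<tau>. Vector_Spaces.linear scale scale \<tau> \<and> inj \<tau> \<and> (\<forall>x. \<tau> (\<phi> x) = \<psi> (\<tau> x)) \<and>
        ((\<forall>q s. irreducible q \<longrightarrow> lead_coeff q = 1 \<longrightarrow> 1 \<le> s \<longrightarrow> g q s ` I q s = I' q s) \<longrightarrow>
          (\<exists>m'. m' \<noteq> 0 \<and> (\<forall>v. B.act m' v = 0)) \<longrightarrow> surj \<tau>)"
      by (rule linear_of_families[OF A.poly_action_axioms B.poly_action_axioms I(1) I'(1) m])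
        (rule g'; assumption)
    then obtain \<tau> where \<tau>': "Vector_Spaces.linear scale scale \<tau> \<and> inj \<tau> \<and> (\<forall>x. \<tau> (\<phi> x) = \<psi> (\<tau> x)) \<and>
        ((\<forall>q s. irreducible q \<longrightarrow> lead_coeff q = 1 \<longrightarrow> 1 \<le> s \<longrightarrow> g q s ` I q s = I' q s) \<longrightarrow>
          (\<exists>m'. m' \<noteq> 0 \<and> (\<forall>v. B.act m' v = 0)) \<longrightarrow> surj \<tau>)" ..
    then have \<tau>: "Vector_Spaces.linear scale scale \<tau>" "inj \<tau>" "\<And>x. \<tau> (\<phi> x) = \<psi> (\<tau> x)"
      by simp_all
    have "surj \<tau>"
    proof (cases ?infinite)
      case True
      have "\<forall>q s. irreducible q \<longrightarrow> lead_coeff q = 1 \<longrightarrow> 1 \<le> s \<longrightarrow> g q s ` I q s = I' q s"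
        using g True by blast
      then show ?thesis using \<tau>' B.annihilated by blast
    next
      case False
      then show ?thesis using finite_dim_inj_imp_surj[OF assms(1) _ \<tau>(1,2)] by blast
    qed
    then have bij: "bij \<tau>" using \<tau>(2) by (simp add: bij_def)
    have "\<psi> = \<tau> \<circ> \<phi> \<circ> inv_into UNIV \<tau>"
      using \<tau>(3) \<open>surj \<tau>\<close> by (auto simp: fun_eq_iff surj_f_inv_f)
    then show ?similar using \<tau>(1) bij by blast
  }
qed

end
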